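(* Let $m\ge 0$ be an integer and let $\psi,\varphi,\phi$ be entire functions with $\psi\not\equiv 0$ and $\phi\not\equiv 0$. Let $\mathbb{S}_{\max}$ be the maximal multi-valued weighted composition operator on $\mathcal{F}^2$ induced by the equation $\psi\cdot f\circ\varphi=\phi\cdot g^{(m)}$. Then $\mathbb{S}_{\max}$ is bounded if the following two conditions hold. (1) The function $\widehat\psi(z)=\psi(z)[\varphi(z)]^m[\phi(z)]^{-1}$ is entire. (2) $\sup_{z\in\mathbb{C}}|\widehat\psi(z)|^2e^{|\varphi(z)|^2-|z|^2}<\infty$. In this case, $\varphi$ is of the form $\varphi(z)=Az+B$ with $A,B\in\mathbb{C}$ and $|A|\le 1$.
   Context: Fock space $\mathcal{F}^2$ is the Hilbert space of entire functions $f$ with $\int_{\mathbb{C}}|f(z)|^2e^{-|z|^2}dV(z)<\infty$, with inner product $\langle f,g\rangle=\frac1\pi\int_{\mathbb{C}}f(z)\overline{g(z)}e^{-|z|^2}dV(z)$, where $dV$ is area measure. A multi-valued linear operator $\mathbb{A}$ on a Hilbert space $\mathcal{H}$ assigns to each $x$ in a subspace $\mathrm{dom}(\mathbb{A})\subset\mathcal{H}$ a nonempty subset $\mathbb{A}(x)\subset\mathcal{H}$ such that its graph $G(\mathbb{A})=\{(x,y):x\in\mathrm{dom}(\mathbb{A}),\,y\in\mathbb{A}(x)\}$ is a linear subspace of $\mathcal{H}\times\mathcal{H}$. The operator $\mathbb{S}_{\max}$ is given by $G(\mathbb{S}_{\max})=\{(f,g)\in\mathcal{F}^2\times\mathcal{F}^2:\psi(z)f(\varphi(z))=\phi(z)g^{(m)}(z)\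 \forall z\in\mathbb{C}\}$. For a multi-valued linear operator $\mathbb{A}$, let $E$ be the closure of the subspace $\mathbb{A}(0)$, and let $\mathbf{A}:\mathrm{dom}(\mathbb{A})\to\mathcal{H}/E$ be the single-valued linear operator $\mathbf{A}(x)=[y]$ for any $y\in\mathbb{A}(x)$, where $\mathcal{H}/E$ has the quotient norm $\|[y]\|=\inf\{\|y-e\|:e\in E\}$. The norm of $\mathbb{A}$ is the operator norm $\|\mathbb{A}\|=\|\mathbf{A}\|$, and $\mathbb{A}$ is bounded if $\|\mathbb{A}\|<\infty$. *)

theory Defs
  imports "HOL-Complex_Analysis.Complex_Analysis"
begin

section \<open>Fock space\<close>

definition fock_weight :: "complex \<Rightarrow> real" where
  "fock_weight z = exp (- (cmod z)\<^sup>2)"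

text \<open>The integrand is continuous and nonnegative, so integrability with respect to area
  measure says exactly that the integral is finite.\<close>

definition fock_set :: "(complex \<Rightarrow> complex) set" where
  "fock_set = {f. f holomorphic_on UNIV \<and>
     integrable lborel (\<lambda>z. (cmod (f z))\<^sup>2 * fock_weight z)}"

lemma fock_weight_pos: "fock_weight z > 0"
  by (simp add: fock_weight_def)

lemma continuous_on_fock_weight: "continuous_on A fock_weight"
  unfolding fock_weight_def[abs_def] by (intro continuous_intros)

lemma fock_set_continuous: "f \<in> fock_set \<Longrightarrow> continuous_on A f"
  by (auto simp: fock_set_def intro: holomorphic_on_imp_continuous_on continuous_on_subset)

lemma borel_measurable_fock_integrand:
  assumes "continuous_on UNIV f" "continuous_on UNIV g"
  shows "(\<lambda>z. f z * cnj (g z) * of_real (fock_weight z)) \<in> borel_measurable lborel"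
proof -
  have "(\<lambda>z. f z * cnj (g z) * of_real (fock_weight z)) \<in> borel_measurable borel"
    by (intro borel_measurable_continuous_onI continuous_intros assms continuous_on_fock_weight)
  then show ?thesis by simp
qed

lemma integrable_fock_integrand:
  assumes "f \<in> fock_set" "g \<in> fock_set"
  shows "integrable lborel (\<lambda>z. f z * cnj (g z) * of_real (fock_weight z))"
proof (rule Bochner_Integration.integrable_bound)
  show "integrable lborel (\<lambda>z. (cmod (f z))\<^sup>2 * fock_weight z + (cmod (g z))\<^sup>2 * fock_weight z)"
    using assms by (auto simp: fock_set_def)
  show "(\<lambda>z. f z * cnj (g z) * of_real (fock_weight z)) \<in> borel_measurable lborel"
    using assms by (intro borel_measurable_fock_integrand fock_set_continuous)
  show "AE z in lborel. norm (f z * cnj (g z) * of_real (fock_weight z))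
      \<le> norm ((cmod (f z))\<^sup>2 * fock_weight z + (cmod (g z))\<^sup>2 * fock_weight z)"
  proof (rule AE_I2)
    fix z
    have "cmod (f z) * cmod (g z) \<le> (cmod (f z))\<^sup>2 + (cmod (g z))\<^sup>2"
      using sum_squares_bound[of "cmod (f z)" "cmod (g z)"]
        mult_nonneg_nonneg[OF norm_ge_zero norm_ge_zero, of "f z" "g z"]
      by linarith
    then have "cmod (f z) * cmod (g z) * fock_weight z
        \<le> ((cmod (f z))\<^sup>2 + (cmod (g z))\<^sup>2) * fock_weight z"
      using fock_weight_pos[of z] by (intro mult_right_mono) auto
    then show "norm (f z * cnj (g z) * of_real (fock_weight z))
      \<le> norm ((cmod (f z))\<^sup>2 * fock_weight z + (cmod (g z))\<^sup>2 * fock_weight z)"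
      using fock_weight_pos[of z] by (simp add: norm_mult algebra_simps)
  qed
qed

lemma fock_set_zero: "(\<lambda>_. 0) \<in> fock_set"
  by (simp add: fock_set_def)

lemma fock_set_add:
  assumes "f \<in> fock_set" "g \<in> fock_set"
  shows "(\<lambda>z. f z + g z) \<in> fock_set"
proof -
  have cont: "continuous_on UNIV f" "continuous_on UNIV g"
    using assms by (auto intro: fock_set_continuous)
  have "integrable lborel (\<lambda>z. (cmod (f z + g z))\<^sup>2 * fock_weight z)"
  proof (rule Bochner_Integration.integrable_bound)
    show "integrable lborel
        (\<lambda>z. 2 * ((cmod (f z))\<^sup>2 * fock_weight z) + 2 * ((cmod (g z))\<^sup>2 * fock_weight z))"
      using assms by (auto simp: fock_set_def)
    have "(\<lambda>z. (cmod (f z + g z))\<^sup>2 * fock_weight z) \<in> borel_measurable borel"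
      by (intro borel_measurable_continuous_onI continuous_intros cont continuous_on_fock_weight)
    then show "(\<lambda>z. (cmod (f z + g z))\<^sup>2 * fock_weight z) \<in> borel_measurable lborel"
      by simp
    show "AE z in lborel. norm ((cmod (f z + g z))\<^sup>2 * fock_weight z)
        \<le> norm (2 * ((cmod (f z))\<^sup>2 * fock_weight z) + 2 * ((cmod (g z))\<^sup>2 * fock_weight z))"
    proof (rule AE_I2)
      fix z
      have "(cmod (f z + g z))\<^sup>2 \<le> (cmod (f z) + cmod (g z))\<^sup>2"
        by (intro power_mono norm_triangle_ineq) auto
      also have "\<dots> \<le> 2 * (cmod (f z))\<^sup>2 + 2 * (cmod (g z))\<^sup>2"
        using sum_squares_bound[of "cmod (f z)" "cmod (g z)"] by (simp add: power2_sum)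
      finally have "(cmod (f z + g z))\<^sup>2 * fock_weight z
          \<le> (2 * (cmod (f z))\<^sup>2 + 2 * (cmod (g z))\<^sup>2) * fock_weight z"
        using fock_weight_pos[of z] by (intro mult_right_mono) auto
      then show "norm ((cmod (f z + g z))\<^sup>2 * fock_weight z)
        \<le> norm (2 * ((cmod (f z))\<^sup>2 * fock_weight z) + 2 * ((cmod (g z))\<^sup>2 * fock_weight z))"
        using fock_weight_pos[of z] by (simp add: algebra_simps)
    qed
  qed
  then show ?thesis
    using assms by (auto simp: fock_set_def intro!: holomorphic_intros)
qed

lemma fock_set_scale:
  assumes "f \<in> fock_set"
  shows "(\<lambda>z. c * f z) \<in> fock_set"
proof -
  have "integrable lborel (\<lambda>z. (cmod c)\<^sup>2 * ((cmod (f z))\<^sup>2 * fock_weight z))"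
    using assms by (auto simp: fock_set_def)
  then show ?thesis
    using assms
    by (auto simp: fock_set_def norm_mult power_mult_distrib mult.assoc intro!: holomorphic_intros)
qed

lemma fock_set_uminus: "f \<in> fock_set \<Longrightarrow> (\<lambda>z. - f z) \<in> fock_set"
  using fock_set_scale[of f "-1"] by simp

lemma fock_set_diff: "f \<in> fock_set \<Longrightarrow> g \<in> fock_set \<Longrightarrow> (\<lambda>z. f z - g z) \<in> fock_set"
  using fock_set_add[OF _ fock_set_uminus, of f g] by simp

typedef fock = fock_set
  morphisms fock_fun Abs_fock
  using fock_set_zero by blast

lemma fock_eqI: "(\<And>z. fock_fun f z = fock_fun g z) \<Longrightarrow> f = g"
  by (metis ext fock_fun_inject)

definition fock_inner :: "fock \<Rightarrow> fock \<Rightarrow> complex" where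
  "fock_inner f g = 1 / of_real pi *
     (LINT z|lborel. fock_fun f z * cnj (fock_fun g z) * of_real (fock_weight z))"

definition fock_scaleC :: "complex \<Rightarrow> fock \<Rightarrow> fock" where
  "fock_scaleC c f = Abs_fock (\<lambda>z. c * fock_fun f z)"

lemma fock_fun_scaleC [simp]: "fock_fun (fock_scaleC c f) z = c * fock_fun f z"
  using fock_fun[of f] by (simp add: fock_scaleC_def Abs_fock_inverse fock_set_scale)

text \<open>The library has no class of complex inner product spaces. The real inner product
  below is the real part of the complex one, so both induce the same norm
  (lemma \<open>fock_inner_self\<close>); complex scalars act through \<open>fock_scaleC\<close>.\<close>

instantiation fock :: ab_group_add
begin
definition zero_fock :: fock where "0 = Abs_fock (\<lambda>_. 0)"
definition plus_fock :: "fock \<Rightarrow> fock \<Rightarrow> fock" where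
  "f + g = Abs_fock (\<lambda>z. fock_fun f z + fock_fun g z)"
definition minus_fock :: "fock \<Rightarrow> fock \<Rightarrow> fock" where
  "f - g = Abs_fock (\<lambda>z. fock_fun f z - fock_fun g z)"
definition uminus_fock :: "fock \<Rightarrow> fock" where
  "- f = Abs_fock (\<lambda>z. - fock_fun f z)"

lemma fock_fun_zero [simp]: "fock_fun 0 z = 0"
  by (simp add: zero_fock_def Abs_fock_inverse fock_set_zero)

lemma fock_fun_plus [simp]: "fock_fun (f + g) z = fock_fun f z + fock_fun g z"
  using fock_fun[of f] fock_fun[of g]
  by (simp add: plus_fock_def Abs_fock_inverse fock_set_add)

lemma fock_fun_minus [simp]: "fock_fun (f - g) z = fock_fun f z - fock_fun g z"
  using fock_fun[of f] fock_fun[of g]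
  by (simp add: minus_fock_def Abs_fock_inverse fock_set_diff)

lemma fock_fun_uminus [simp]: "fock_fun (- f) z = - fock_fun f z"
  using fock_fun[of f]
  by (simp add: uminus_fock_def Abs_fock_inverse fock_set_uminus)

instance by standard (auto intro!: fock_eqI)
end

instantiation fock :: real_vector
begin
definition scaleR_fock :: "real \<Rightarrow> fock \<Rightarrow> fock" where
  "c *\<^sub>R f = fock_scaleC (of_real c) f"
instance by standard (auto intro!: fock_eqI simp: scaleR_fock_def algebra_simps)
end

lemma fock_inner_add_left: "fock_inner (f + g) h = fock_inner f h + fock_inner g h"
  using integrable_fock_integrand[OF fock_fun fock_fun, of f h]
    integrable_fock_integrand[OF fock_fun fock_fun, of g h]
  by (simp add: fock_inner_def distrib_right distrib_left)

lemma fock_inner_scaleC_left: "fock_inner (fock_scaleC c f) g = c * fock_inner f g"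
  by (simp add: fock_inner_def mult.assoc)

lemma fock_inner_cnj: "fock_inner g f = cnj (fock_inner f g)"
proof -
  have "(LINT z|lborel. cnj (fock_fun f z * cnj (fock_fun g z) * of_real (fock_weight z)))
      = cnj (LINT z|lborel. fock_fun f z * cnj (fock_fun g z) * of_real (fock_weight z))"
    by (rule Bochner_Integration.integral_cnj)
  then show ?thesis
    by (simp add: fock_inner_def mult_ac)
qed

lemma fock_inner_self:
  "fock_inner f f =
     of_real (1 / pi * (LINT z|lborel. (cmod (fock_fun f z))\<^sup>2 * fock_weight z))"
proof -
  have "fock_fun f z * cnj (fock_fun f z) * of_real (fock_weight z)
      = of_real ((cmod (fock_fun f z))\<^sup>2 * fock_weight z)" for z
    by (simp add: complex_norm_square del: of_real_power)
  then show ?thesis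
    by (simp add: fock_inner_def del: of_real_mult)
qed

lemma fock_inner_self_eq_0:
  assumes "fock_inner f f = 0"
  shows "f = 0"
proof (rule fock_eqI)
  fix z
  let ?w = "\<lambda>z. (cmod (fock_fun f z))\<^sup>2 * fock_weight z"
  have cont: "continuous_on UNIV ?w"
    by (intro continuous_intros continuous_on_fock_weight fock_set_continuous fock_fun)
  have "(LINT z|lborel. ?w z) = 0"
    using assms unfolding fock_inner_self of_real_eq_0_iff by simp
  moreover have "integrable lborel ?w"
    using fock_fun[of f] by (simp add: fock_set_def)
  ultimately have "AE z in lborel. ?w z = 0"
    using integral_nonneg_eq_0_iff_AE[of lborel ?w] fock_weight_pos
    by (simp add: less_imp_le)
  moreover have "closed {z. ?w z = 0}"
    by (rule closed_Collect_eq[OF cont continuous_on_const])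
  ultimately have "?w z = 0"
    using mem_closed_if_AE_lebesgue[of "{z. ?w z = 0}" z] by (simp add: AE_completion)
  then show "fock_fun f z = fock_fun 0 z"
    using fock_weight_pos[of z] by simp
qed

instantiation fock :: real_inner
begin
definition inner_fock :: "fock \<Rightarrow> fock \<Rightarrow> real" where
  "(f::fock) \<bullet> g = Re (fock_inner f g)"
definition norm_fock :: "fock \<Rightarrow> real" where
  "norm (f::fock) = sqrt (f \<bullet> f)"
definition sgn_fock :: "fock \<Rightarrow> fock" where
  "sgn (f::fock) = f /\<^sub>R norm f"
definition dist_fock :: "fock \<Rightarrow> fock \<Rightarrow> real" where
  "dist (f::fock) g = norm (f - g)"
definition uniformity_fock :: "(fock \<times> fock) filter" where
  "uniformity_fock = (INF e\<in>{0<..}. principal {(f, g). dist f g < e})"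
definition open_fock :: "fock set \<Rightarrow> bool" where
  "open_fock U \<longleftrightarrow> (\<forall>f\<in>U. eventually (\<lambda>(f', g). f' = f \<longrightarrow> g \<in> U) uniformity)"

instance
proof
  fix f g h :: fock and r :: real
  show "dist f g = norm (f - g)" by (rule dist_fock_def)
  show "sgn f = f /\<^sub>R norm f" by (rule sgn_fock_def)
  show "(uniformity :: (fock \<times> fock) filter) = (INF e\<in>{0<..}. principal {(f, g). dist f g < e})"
    by (rule uniformity_fock_def)
  show "open U \<longleftrightarrow> (\<forall>f\<in>U. eventually (\<lambda>(f', g). f' = f \<longrightarrow> g \<in> U) uniformity)" for U :: "fock set"
    by (rule open_fock_def)
  show "f \<bullet> g = g \<bullet> f"
    by (subst (2) inner_fock_def, subst fock_inner_cnj) (simp add: inner_fock_def)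
  show "(f + g) \<bullet> h = f \<bullet> h + g \<bullet> h"
    by (simp add: inner_fock_def fock_inner_add_left)
  show "(r *\<^sub>R f) \<bullet> g = r * (f \<bullet> g)"
    by (simp add: inner_fock_def scaleR_fock_def fock_inner_scaleC_left)
  have self: "f \<bullet> f = 1 / pi * (LINT z|lborel. (cmod (fock_fun f z))\<^sup>2 * fock_weight z)"
    unfolding inner_fock_def fock_inner_self by (rule Re_complex_of_real)
  show "0 \<le> f \<bullet> f"
    unfolding self using fock_weight_pos
    by (intro mult_nonneg_nonneg Bochner_Integration.integral_nonneg) (auto intro: less_imp_le)
  show "f \<bullet> f = 0 \<longleftrightarrow> f = 0"
  proof
    assume "f \<bullet> f = 0"
    then show "f = 0"
      by (intro fock_inner_self_eq_0) (simp add: fock_inner_self inner_fock_def)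
  qed (simp add: inner_fock_def fock_inner_def)
  show "norm f = sqrt (f \<bullet> f)" by (rule norm_fock_def)
qed
end

section \<open>Multi-valued linear operators\<close>

text \<open>A multi-valued operator is represented by its graph \<open>G\<close>: its domain is \<open>Domain G\<close> and its
  value at \<open>x\<close> is the set \<open>G `` {x}\<close>, nonempty for \<open>x\<close> in the domain. Complex scalar
  multiplication is passed explicitly as \<open>sc\<close>.\<close>

definition mv_linear :: "(complex \<Rightarrow> 'a \<Rightarrow> 'a) \<Rightarrow> ('a::real_normed_vector \<times> 'a) set \<Rightarrow> bool" where
  "mv_linear sc G \<longleftrightarrow> module.subspace (\<lambda>c (x, y). (sc c x, sc c y)) G"

definition mv_E :: "('a::real_normed_vector \<times> 'a) set \<Rightarrow> 'a set" where
  "mv_E G = closure (G `` {0})"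

definition quot_class :: "'a::real_normed_vector set \<Rightarrow> 'a \<Rightarrow> 'a set" where
  "quot_class E y = (\<lambda>e. y - e) ` E"

text \<open>Applied to the class of \<open>y\<close> this is the infimum of \<open>norm (y - e)\<close> over \<open>e \<in> E\<close>.\<close>

definition quot_norm :: "'a::real_normed_vector set \<Rightarrow> real" where
  "quot_norm C = (INF v\<in>C. norm v)"

text \<open>The choice of \<open>y\<close> is immaterial for linear \<open>G\<close>: see \<open>mv_single_eq\<close>.\<close>

definition mv_single :: "('a::real_normed_vector \<times> 'a) set \<Rightarrow> 'a \<Rightarrow> 'a set" where
  "mv_single G x = quot_class (mv_E G) (SOME y. (x, y) \<in> G)"

definition mv_norm :: "('a::real_normed_vector \<times> 'a) set \<Rightarrow> ereal" where
  "mv_norm G = (SUP x\<in>{x \<in> Domain G. norm x \<le> 1}. ereal (quot_norm (mv_single G x)))"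

definition mv_bounded :: "('a::real_normed_vector \<times> 'a) set \<Rightarrow> bool" where
  "mv_bounded G \<longleftrightarrow> mv_norm G < \<infinity>"

lemma fock_prod_module: "module (\<lambda>c (x, y). (fock_scaleC c x, fock_scaleC c y))"
  by standard (auto intro!: fock_eqI simp: algebra_simps)

lemma mv_single_eq:
  assumes "mv_linear fock_scaleC G" "(x, y) \<in> G"
  shows "mv_single G x = quot_class (mv_E G) y"
proof -
  note sub = assms(1)[unfolded mv_linear_def]
  have diff: "p - q \<in> G" if "p \<in> G" "q \<in> G" for p q
    using module.subspace_diff[OF fock_prod_module sub that] .
  have sum: "p + q \<in> G" if "p \<in> G" "q \<in> G" for p q
    using module.subspace_add[OF fock_prod_module sub that] .
  define y' where "y' = (SOME y. (x, y) \<in> G)"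
  have y': "(x, y') \<in> G"
    unfolding y'_def using assms(2) by (rule someI)
  have E: "u + e \<in> mv_E G" if u: "(0, u) \<in> G" and "e \<in> mv_E G" for u e
  proof -
    have "(+) u ` (G `` {0}) \<subseteq> G `` {0}"
      using sum[OF u] by auto
    then have "closure ((+) u ` (G `` {0})) \<subseteq> mv_E G"
      unfolding mv_E_def by (rule closure_mono)
    then show ?thesis
      using that by (auto simp: closure_translation mv_E_def)
  qed
  have "quot_class (mv_E G) v \<subseteq> quot_class (mv_E G) w" if "(x, v) \<in> G" "(x, w) \<in> G" for v w
  proof
    fix p assume "p \<in> quot_class (mv_E G) v"
    then obtain e where e: "e \<in> mv_E G" "p = v - e"
      by (auto simp: quot_class_def)
    have "(0, w - v) \<in> G"
      using diff[OF that(2,1)] by simp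
    from E[OF this e(1)] show "p \<in> quot_class (mv_E G) w"
      using e(2) by (auto simp: quot_class_def intro!: image_eqI[of _ _ "w - v + e"])
  qed
  then show ?thesis
    unfolding mv_single_def y'_def[symmetric] using y' assms(2) by blast
qed

lemma quot_norm_class: "quot_norm (quot_class E y) = (INF e\<in>E. norm (y - e))"
  by (simp add: quot_norm_def quot_class_def image_image)

section \<open>The maximal weighted composition operator\<close>

text \<open>Here \<open>\<psi>\<close> is the weight, \<open>\<phi>\<close> the composition symbol and \<open>\<eta>\<close> the coefficient of the derivative:
  the operator is induced by \<open>\<psi> z * f (\<phi> z) = \<eta> z * (deriv ^^ m) g z\<close>.\<close>

definition S_max ::
    "nat \<Rightarrow> (complex \<Rightarrow> complex) \<Rightarrow> (complex \<Rightarrow> complex) \<Rightarrow> (complex \<Rightarrow> complex) \<Rightarrow> (fock \<times> fock) set" where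
  "S_max m \<psi> \<phi> \<eta> = {(f, g). \<forall>z. \<psi> z * fock_fun f (\<phi> z) = \<eta> z * (deriv ^^ m) (fock_fun g) z}"

lemma S_max_linear: "mv_linear fock_scaleC (S_max m \<psi> \<phi> \<eta>)"
proof -
  have hol: "fock_fun g holomorphic_on UNIV" for g
    using fock_fun[of g] by (simp add: fock_set_def)
  have "fock_fun (g + h) = (\<lambda>z. fock_fun g z + fock_fun h z)" for g h
    by auto
  then have add: "(deriv ^^ m) (fock_fun (g + h)) z
      = (deriv ^^ m) (fock_fun g) z + (deriv ^^ m) (fock_fun h) z" for g h z
    using higher_deriv_add[OF hol[of g] hol[of h], of z m] by simp
  have "fock_fun (fock_scaleC c g) = (\<lambda>z. c * fock_fun g z)" for c g
    by auto
  then have scale: "(deriv ^^ m) (fock_fun (fock_scaleC c g)) z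
      = c * (deriv ^^ m) (fock_fun g) z" for c g z
    using higher_deriv_cmult[OF hol[of g], of z m c] by simp
  have "fock_fun 0 = (\<lambda>z. 0)"
    by auto
  then have zero: "(deriv ^^ m) (fock_fun 0) z = 0" for z
    by simp
  show ?thesis
    unfolding mv_linear_def module.subspace_def[OF fock_prod_module]
    by (auto simp: S_max_def zero_prod_def add scale zero distrib_left mult.left_commute)
qed

text \<open>The quotient as a meromorphic function: \<open>remove_sings\<close> fills in the limit at zeros of the
  denominator where it exists. At a genuine pole it assigns \<open>0\<close>, which leaves the function
  discontinuous there, so holomorphy on the plane says that there are no poles.\<close>

definition psi_hat ::
    "nat \<Rightarrow> (complex \<Rightarrow> complex) \<Rightarrow> (complex \<Rightarrow> complex) \<Rightarrow> (complex \<Rightarrow> complex) \<Rightarrow> complex \<Rightarrow> complex" where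
  "psi_hat m \<psi> \<phi> \<eta> = remove_sings (\<lambda>z. \<psi> z * \<phi> z ^ m * inverse (\<eta> z))"

lemma psi_hat_entire_iff:
  assumes "\<psi> holomorphic_on UNIV" "\<phi> holomorphic_on UNIV" "\<eta> holomorphic_on UNIV" "\<eta> \<noteq> (\<lambda>_. 0)"
  shows "psi_hat m \<psi> \<phi> \<eta> holomorphic_on UNIV \<longleftrightarrow>
    (\<exists>h. h holomorphic_on UNIV \<and> (\<forall>z. \<eta> z \<noteq> 0 \<longrightarrow> h z = \<psi> z * \<phi> z ^ m * inverse (\<eta> z)))"
    (is "?L \<longleftrightarrow> ?R")
proof -
  let ?q = "\<lambda>z. \<psi> z * \<phi> z ^ m * inverse (\<eta> z)"
  obtain w where w: "\<eta> w \<noteq> 0"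
    using assms(4) by auto
  have nz: "eventually (\<lambda>z. \<eta> z \<noteq> 0) (at z)" for z
  proof (cases "\<eta> z = 0")
    case True
    then show ?thesis
      using non_zero_neighbour_alt[OF assms(3) open_UNIV connected_UNIV, of z w] w by simp
  next
    case False
    then show ?thesis
      using non_zero_neighbour_alt[OF assms(3) open_UNIV connected_UNIV, of z w] w by simp
  qed
  have ana: "?q analytic_on {z}" if "\<eta> z \<noteq> 0" for z
    using that assms(1-3)
    by (intro analytic_intros) (auto simp: analytic_on_holomorphic)
  have eq: "psi_hat m \<psi> \<phi> \<eta> z = ?q z" if "\<eta> z \<noteq> 0" for z
    unfolding psi_hat_def by (rule remove_sings_at_analytic[OF ana[OF that]])
  show ?thesis
  proof
    assume ?L
    then show ?R
      using eq by (intro exI[of _ "psi_hat m \<psi> \<phi> \<eta>"]) auto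
  next
    assume ?R
    then obtain h where h: "h holomorphic_on UNIV" "\<And>z. \<eta> z \<noteq> 0 \<Longrightarrow> h z = ?q z"
      by blast
    have "psi_hat m \<psi> \<phi> \<eta> z = h z" for z
      unfolding psi_hat_def
    proof (rule remove_sings_eqI)
      have "continuous_on UNIV h"
        using h(1) by (rule holomorphic_on_imp_continuous_on)
      then have "h \<midarrow>z\<rightarrow> h z"
        by (simp add: continuous_on_def)
      moreover have "eventually (\<lambda>x. h x = ?q x) (at z)"
        using nz[of z] by (rule eventually_mono) (use h(2) in auto)
      ultimately show "?q \<midarrow>z\<rightarrow> h z"
        by (rule Lim_transform_eventually)
    qed
    then show ?L
      using h(1) by (metis ext)
  qed
qed

end

theory Submission
  imports Defs "HOL-Real_Asymp.Real_Asymp"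
begin

text \<open>
  Write \<open>h\<close> for \<open>psi_hat m \<psi> \<phi> \<eta>\<close>. The two conclusions have separate reasons.

  \<^bold>\<open>The symbol is affine.\<close> If \<open>h\<close> vanishes identically, so does \<open>\<phi>\<close>. Otherwise fix \<open>a\<close> with
  \<open>h a \<noteq> 0\<close> and write \<open>\<phi> z = T z + (z - a)^n * q z\<close> with \<open>T\<close> the Taylor polynomial of degree below
  \<open>n\<close> at \<open>a\<close>. On the circle of radius \<open>r\<close> about \<open>a\<close> the entire function \<open>h * exp (s * q)\<close> with
  \<open>\<bar>s\<bar> = r^(2 * n) * \<bar>q a\<bar>\<close> is controlled by the growth condition, because
  \<open>t * \<bar>\<phi>\<bar> \<le> t\<^sup>2 / 2 + \<bar>\<phi>\<bar>\<^sup>2 / 2\<close>. Its modulus at \<open>a\<close> is \<open>\<bar>h a\<bar> * exp (r^(2 * n) * \<bar>q a\<bar>\<^sup>2)\<close>, and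
  the mean value inequality then bounds \<open>r^(2 * n) * \<bar>q a\<bar>\<^sup>2 / 2\<close> by \<open>r\<^sup>2 / 2 + O(r^(2 * n - 1))\<close>
  (\<open>gaussian_growth_remainder_bound\<close>). As \<open>r\<close> tends to infinity, \<open>n = 2\<close> yields \<open>\<phi>'' = 0\<close>
  wherever \<open>h\<close> does not vanish, hence everywhere, and \<open>n = 1\<close> yields \<open>\<bar>A\<bar> \<le> 1\<close>. Using this
  perturbed exponential in place of the subharmonicity of \<open>ln \<bar>h\<bar>\<close> avoids any discussion of the
  zeros of \<open>h\<close>.

  \<^bold>\<open>Boundedness.\<close> The multi-valued part \<open>S_max(0)\<close> consists of the polynomials of degree below
  \<open>m\<close>, so it suffices to bound the distance of \<open>g\<close> to those polynomials by a multiple of the norm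
  of \<open>f\<close> whenever \<open>(f, g)\<close> lies in the graph.

  If \<open>\<phi>\<close> is a constant \<open>B\<close>, then \<open>g^(m)\<close> depends on \<open>f\<close> only through the number \<open>f B\<close>, so modulo
  \<open>S_max(0)\<close> the operator has rank at most one, and point evaluation is continuous.

  If \<open>\<phi> z = A * z + B\<close> with \<open>A \<noteq> 0\<close>, the defining equation becomes \<open>h * f \<circ> \<phi> = \<phi>^m * g^(m)\<close>, and
  the growth condition with the substitution \<open>w = A * z + B\<close> bounds the Gaussian \<open>L\<^sup>2\<close> norm of
  \<open>\<phi>^m * g^(m)\<close> by that of \<open>f\<close>. The point \<open>-B / A\<close> is then moved to the origin: the norm of
  \<open>z^m * u\<close> is at most a multiple of that of \<open>(z + B / A)^m * u\<close>, since the second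
  factor dominates the first away from \<open>-B / A\<close> and the maximum principle handles the disc around it
  (\<open>gauss_energy_recentre_power\<close>). Finally a Hardy type inequality for radial weights
  (\<open>radial_energy_higher_primitive\<close>) provides \<open>G\<close> with \<open>G^(m) = g^(m)\<close> whose norm is at most
  \<open>(2 * \<pi>)^m\<close> times that of \<open>z^m * g^(m)\<close>. That inequality holds circle by circle: on each circle
  about the origin a primitive vanishing at \<open>0\<close> has mean zero, hence is controlled by its
  angular derivative.
\<close>

section \<open>Area integrals under complex affine maps\<close>

text \<open>Area measure on the plane is the product of the lengths on the two axes; this opens the way to
  Fubini in Cartesian coordinates.\<close>

lemma lborel_complex_eq_distr:
  "(lborel :: complex measure) = distr (lborel \<Otimes>\<^sub>M lborel) borel (\<lambda>(x, y). Complex x y)"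
proof (rule lborel_eqI)
  have meas[measurable]: "(\<lambda>(x, y). Complex x y) \<in> (lborel \<Otimes>\<^sub>M lborel) \<rightarrow>\<^sub>M borel"
  proof -
    have "(\<lambda>p::real\<times>real. Complex (fst p) (snd p)) \<in> borel_measurable borel"
      by (intro borel_measurable_continuous_onI) (auto simp: Complex_eq intro!: continuous_intros)
    then show ?thesis by (simp add: lborel_prod case_prod_beta)
  qed
  fix l u :: complex
  assume le': "\<And>b. b \<in> Basis \<Longrightarrow> l \<bullet> b \<le> u \<bullet> b"
  have le: "Re l \<le> Re u" "Im l \<le> Im u"
    using le'[of 1] le'[of \<i>] by (auto simp: Basis_complex_def)
  have "(\<lambda>(x, y). Complex x y) -` box l u \<inter> space (lborel \<Otimes>\<^sub>M lborel)
      = {Re l<..<Re u} \<times> {Im l<..<Im u}"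
    by (auto simp: box_def Basis_complex_def space_pair_measure)
  then have "emeasure (distr (lborel \<Otimes>\<^sub>M lborel) borel (\<lambda>(x, y). Complex x y)) (box l u)
      = emeasure (lborel \<Otimes>\<^sub>M lborel) ({Re l<..<Re u} \<times> {Im l<..<Im u})"
    by (subst emeasure_distr) auto
  also have "\<dots> = ennreal (Re u - Re l) * ennreal (Im u - Im l)"
    using le by (subst lborel.emeasure_pair_measure_Times) auto
  also have "\<dots> = (\<Prod>b\<in>Basis. (u - l) \<bullet> b)"
    using le by (auto simp: Basis_complex_def ennreal_mult[symmetric])
  finally show "emeasure (distr (lborel \<Otimes>\<^sub>M lborel) borel (\<lambda>(x, y). Complex x y)) (box l u)
      = (\<Prod>b\<in>Basis. (u - l) \<bullet> b)" .
qed simp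

lemma measurable_Complex[measurable]:
  assumes "f \<in> borel_measurable M" "g \<in> borel_measurable M"
  shows "(\<lambda>x. Complex (f x) (g x)) \<in> borel_measurable M"
  using assms unfolding Complex_eq by measurable

lemma nn_integral_complex_Fubini:
  assumes [measurable]: "f \<in> borel_measurable borel"
  shows "(\<integral>\<^sup>+z. f z \<partial>lborel) = (\<integral>\<^sup>+x. \<integral>\<^sup>+y. f (Complex x y) \<partial>lborel \<partial>lborel)"
    and "(\<integral>\<^sup>+z. f z \<partial>lborel) = (\<integral>\<^sup>+y. \<integral>\<^sup>+x. f (Complex x y) \<partial>lborel \<partial>lborel)"
proof -
  have "(\<integral>\<^sup>+z. f z \<partial>lborel) = (\<integral>\<^sup>+p. f (case p of (x, y) \<Rightarrow> Complex x y) \<partial>(lborel \<Otimes>\<^sub>M lborel))"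
    by (subst lborel_complex_eq_distr, subst nn_integral_distr) (auto simp: split_beta)
  also have "\<dots> = (\<integral>\<^sup>+x. \<integral>\<^sup>+y. f (Complex x y) \<partial>lborel \<partial>lborel)"
    by (subst lborel.nn_integral_fst[symmetric]) (auto simp: split_beta)
  finally show *: "(\<integral>\<^sup>+z. f z \<partial>lborel) = (\<integral>\<^sup>+x. \<integral>\<^sup>+y. f (Complex x y) \<partial>lborel \<partial>lborel)" .
  show "(\<integral>\<^sup>+z. f z \<partial>lborel) = (\<integral>\<^sup>+y. \<integral>\<^sup>+x. f (Complex x y) \<partial>lborel \<partial>lborel)"
    unfolding * by (rule lborel_pair.Fubini') measurable
qed

text \<open>In coordinates the real matrix of multiplication by \<open>A\<close> factors into two shears and a diagonal
  matrix as soon as its upper left entry \<open>Re A\<close> is nonzero. So two one-dimensional affine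
  substitutions, one in each variable, suffice.\<close>

lemma nn_integral_complex_mult_Re_nonzero:
  fixes A :: complex
  assumes [measurable]: "f \<in> borel_measurable borel" and A: "Re A \<noteq> 0"
  shows "(\<integral>\<^sup>+z. f z \<partial>lborel) = ennreal ((cmod A)\<^sup>2) * (\<integral>\<^sup>+z. f (A * z) \<partial>lborel)"
proof -
  define a b D where "a = Re A" and "b = Im A" and "D = (cmod A)\<^sup>2"
  have a: "a \<noteq> 0" and D: "D = a\<^sup>2 + b\<^sup>2" "D > 0"
    using A by (auto simp: a_def b_def D_def cmod_power2 sum_power2_gt_zero_iff)
  \<comment> \<open>Substituting \<open>v = b / a * u + D / a * y\<close> and then \<open>u = a * x - b * y\<close> reproduces \<open>A * (x + \<i> * y)\<close>;
      the Jacobians \<open>\<bar>D / a\<bar>\<close> and \<open>\<bar>a\<bar>\<close> multiply to \<open>D\<close>.\<close>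
  have A_mult: "A * Complex x y = Complex (a * x - b * y) (b * x + a * y)" for x y
    by (simp add: complex_eq_iff a_def b_def)
  have x_subst: "(\<integral>\<^sup>+x. f (Complex x (b / a * x + D / a * y)) \<partial>lborel)
      = \<bar>a\<bar> * (\<integral>\<^sup>+x. f (A * Complex x y) \<partial>lborel)" for y
  proof -
    have "b / a * (- b * y + a * x) + D / a * y = b * x + a * y" for x
      using a by (simp add: D field_simps power2_eq_square)
    then show ?thesis
      by (subst nn_integral_real_affine[where c = a and t = "- b * y"])
         (simp_all add: a A_mult algebra_simps)
  qed
  have "(\<integral>\<^sup>+z. f z \<partial>lborel) = (\<integral>\<^sup>+x. \<integral>\<^sup>+y. f (Complex x y) \<partial>lborel \<partial>lborel)"
    by (rule nn_integral_complex_Fubini) measurable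
  also have "\<dots> = (\<integral>\<^sup>+x. \<bar>D / a\<bar> * (\<integral>\<^sup>+y. f (Complex x (b / a * x + D / a * y)) \<partial>lborel) \<partial>lborel)"
    using a D by (intro nn_integral_cong nn_integral_real_affine) auto
  also have "\<dots> = \<bar>D / a\<bar> * (\<integral>\<^sup>+x. \<integral>\<^sup>+y. f (Complex x (b / a * x + D / a * y)) \<partial>lborel \<partial>lborel)"
    by (rule nn_integral_cmult) measurable
  also have "(\<integral>\<^sup>+x. \<integral>\<^sup>+y. f (Complex x (b / a * x + D / a * y)) \<partial>lborel \<partial>lborel)
      = (\<integral>\<^sup>+y. \<integral>\<^sup>+x. f (Complex x (b / a * x + D / a * y)) \<partial>lborel \<partial>lborel)"
    by (rule lborel_pair.Fubini') measurable
  also have "\<dots> = \<bar>a\<bar> * (\<integral>\<^sup>+y. \<integral>\<^sup>+x. f (A * Complex x y) \<partial>lborel \<partial>lborel)"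
    unfolding x_subst by (rule nn_integral_cmult) measurable
  also have "(\<integral>\<^sup>+y. \<integral>\<^sup>+x. f (A * Complex x y) \<partial>lborel \<partial>lborel) = (\<integral>\<^sup>+z. f (A * z) \<partial>lborel)"
    by (rule nn_integral_complex_Fubini(2)[symmetric]) measurable
  finally show ?thesis
    using a D by (simp add: mult.assoc[symmetric] ennreal_mult[symmetric] D_def[symmetric] abs_mult[symmetric])
qed

text \<open>A purely imaginary \<open>A\<close> is the product of \<open>1 + \<i>\<close> and \<open>A / (1 + \<i>)\<close>, both with nonzero real part.
  For \<open>\<bar>A\<bar> = 1\<close> this is the rotation invariance of area.\<close>

lemma nn_integral_complex_affine:
  fixes A B :: complex
  assumes [measurable]: "f \<in> borel_measurable borel" and A: "A \<noteq> 0"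
  shows "(\<integral>\<^sup>+z. f z \<partial>lborel) = ennreal ((cmod A)\<^sup>2) * (\<integral>\<^sup>+z. f (A * z + B) \<partial>lborel)"
proof -
  have mult: "(\<integral>\<^sup>+z. g z \<partial>lborel) = ennreal ((cmod A)\<^sup>2) * (\<integral>\<^sup>+z. g (A * z) \<partial>lborel)"
    if [measurable]: "g \<in> borel_measurable borel" for g
  proof (cases "Re A = 0")
    case True
    define c where "c = Complex 1 1"
    have "A = c * ((A / c))" and [simp]: "Re c \<noteq> 0" and Re: "Re (A / c) \<noteq> 0" and c0: "c \<noteq> 0"
      using True A by (auto simp: c_def complex_eq_iff Re_divide)
    have "(\<integral>\<^sup>+z. g z \<partial>lborel) = ennreal ((cmod c)\<^sup>2) * (\<integral>\<^sup>+z. g (c * z) \<partial>lborel)"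
      by (rule nn_integral_complex_mult_Re_nonzero) auto
    also have "(\<integral>\<^sup>+z. g (c * z) \<partial>lborel)
        = ennreal ((cmod (A / c))\<^sup>2) * (\<integral>\<^sup>+z. g (c * (A / c * z)) \<partial>lborel)"
      using Re by (intro nn_integral_complex_mult_Re_nonzero[of "\<lambda>z. g (c * z)"]) auto
    finally show ?thesis
      using c0 by (simp add: mult.assoc[symmetric] ennreal_mult[symmetric] norm_divide power_divide)
  qed (rule nn_integral_complex_mult_Re_nonzero[OF that])
  have "(\<integral>\<^sup>+z. f z \<partial>lborel) = (\<integral>\<^sup>+z. f (B + z) \<partial>lborel)"
    by (subst lborel_distr_plus[of B, symmetric], subst nn_integral_distr) auto
  then show ?thesis
    using mult[of "\<lambda>z. f (B + z)"] by (simp add: add.commute)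
qed

section \<open>Means of entire functions over circles\<close>

text \<open>Averaging over all rotations about the origin leaves an area integral unchanged. This is how
  estimates on circles turn into estimates on the plane without polar coordinates.\<close>

lemma nn_integral_rotation_average:
  fixes K :: "complex \<Rightarrow> ennreal"
  assumes [measurable]: "K \<in> borel_measurable borel"
  shows "(\<integral>\<^sup>+z. \<integral>\<^sup>+t. K (z * exp (2 * of_real pi * \<i> * of_real t)) * indicator {0..1::real} t \<partial>lborel \<partial>lborel)
       = (\<integral>\<^sup>+z. K z \<partial>lborel)"
proof -
  let ?e = "\<lambda>t::real. exp (2 * of_real pi * \<i> * of_real t) :: complex"
  have rotate: "(\<integral>\<^sup>+z. K (z * ?e t) \<partial>lborel) = (\<integral>\<^sup>+z. K z \<partial>lborel)" for t
    using nn_integral_complex_affine[of K "?e t" 0] by (simp add: mult.commute)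
  have "(\<integral>\<^sup>+z. \<integral>\<^sup>+t. K (z * ?e t) * indicator {0..1} t \<partial>lborel \<partial>lborel)
      = (\<integral>\<^sup>+t. \<integral>\<^sup>+z. K (z * ?e t) * indicator {0..1} t \<partial>lborel \<partial>lborel)"
    by (rule lborel_pair.Fubini') measurable
  also have "\<dots> = (\<integral>\<^sup>+t. (\<integral>\<^sup>+z. K z \<partial>lborel) * indicator {0..1::real} t \<partial>lborel)"
    by (subst nn_integral_multc) (auto simp: rotate)
  also have "\<dots> = (\<integral>\<^sup>+z. K z \<partial>lborel)"
    by (subst nn_integral_cmult) auto
  finally show ?thesis .
qed

text \<open>The Cauchy-Schwarz inequality against the constant function on an interval of length one.\<close>

lemma norm_integral_power2_le_nn_integral:
  fixes k :: "real \<Rightarrow> complex"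
  assumes k: "continuous_on {0..1} k"
  shows "ennreal ((cmod (integral {0..1} k))\<^sup>2)
       \<le> (\<integral>\<^sup>+t. ennreal ((cmod (k t))\<^sup>2) * indicator {0..1} t \<partial>lborel)"
proof -
  define c where "c = integral {0..1} (\<lambda>t. cmod (k t))"
  have int1: "(\<lambda>t. cmod (k t)) integrable_on {0..1}"
    and int2: "(\<lambda>t. (cmod (k t))\<^sup>2) integrable_on {0..1}"
    by (intro integrable_continuous_real continuous_intros k)+
  \<comment> \<open>The integrand is \<open>(cmod (k t) - c)\<^sup>2\<close>: a variance is nonnegative.\<close>
  have "((\<lambda>t. (cmod (k t))\<^sup>2 + c\<^sup>2 - 2 * c * cmod (k t)) has_integral
      integral {0..1} (\<lambda>t. (cmod (k t))\<^sup>2) + c\<^sup>2 - 2 * c * c) {0..1}"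
    unfolding c_def
    using has_integral_const_real[of "c\<^sup>2" 0 1]
    by (intro has_integral_diff has_integral_add has_integral_mult_right
        integrable_integral int1 int2) (simp add: c_def)
  moreover have "0 \<le> (cmod (k t))\<^sup>2 + c\<^sup>2 - 2 * c * cmod (k t)" for t
    using zero_le_power2[of "cmod (k t) - c"] by (simp add: power2_diff mult_ac)
  ultimately have "0 \<le> integral {0..1} (\<lambda>t. (cmod (k t))\<^sup>2) + c\<^sup>2 - 2 * c * c"
    by (rule has_integral_nonneg) 
  then have "c\<^sup>2 \<le> integral {0..1} (\<lambda>t. (cmod (k t))\<^sup>2)"
    by (simp add: power2_eq_square)
  moreover have "cmod (integral {0..1} k) \<le> c"
    unfolding c_def by (intro integral_norm_bound_integral integrable_continuous_real k int1) auto
  then have "(cmod (integral {0..1} k))\<^sup>2 \<le> c\<^sup>2"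
    by (intro power_mono) auto
  ultimately have "(cmod (integral {0..1} k))\<^sup>2 \<le> integral {0..1} (\<lambda>t. (cmod (k t))\<^sup>2)"
    by linarith
  moreover have "(\<integral>\<^sup>+t. ennreal (indicator {0..1} t * (cmod (k t))\<^sup>2) \<partial>lborel)
      = ennreal (integral {0..1} (\<lambda>t. (cmod (k t))\<^sup>2))"
    using nn_integral_has_integral_lebesgue[OF _ integrable_integral[OF int2]]
    by simp
  ultimately show ?thesis
    by (simp add: ennreal_mult'' ennreal_indicator mult.commute ennreal_leI)
qed

text \<open>The circle is parametrised as \<open>w + z * exp (2 * \<pi> * \<i> * t)\<close>, so that its radius \<open>\<bar>z\<bar>\<close> and its
  starting point are given by a single complex number over which area integrals can be taken; the
  circle may be degenerate.\<close>

lemma entire_circle_mean: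
  assumes F: "F holomorphic_on UNIV"
  shows "((\<lambda>t. F (w + z * exp (2 * of_real pi * \<i> * of_real t))) has_integral F w) {0..1}"
proof -
  have "(\<lambda>\<zeta>. F (w + z * \<zeta>)) holomorphic_on cball 0 1"
    by (intro holomorphic_on_compose_gen[of _ _ F, unfolded o_def, OF _ F] holomorphic_intros) auto
  from Cauchy_integral_circlepath_simple[OF this, of 0]
  have "((\<lambda>u. F (w + z * u) / u) has_contour_integral 2 * of_real pi * \<i> * F w) (circlepath 0 1)"
    by simp
  then have "((\<lambda>t. F (w + z * exp (2 * of_real pi * \<i> * of_real t)) * (2 * of_real pi * \<i>))
      has_integral F w * (2 * of_real pi * \<i>)) {0..1}"
    unfolding has_contour_integral_def
    by (simp only: mult.commute[of "F w"])
       (erule has_integral_eq[rotated], simp add: vector_derivative_circlepath01, simp add: circlepath)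
  from has_integral_mult_left[OF this, of "1 / (2 * of_real pi * \<i>)"] show ?thesis
    by simp
qed

text \<open>Integration by parts on a circle: with \<open>q t = G (z * exp (2 * \<pi> * \<i> * t))\<close> one has
  \<open>(t * q t)' = q t + t * q' t\<close>, and \<open>q\<close> has mean \<open>G 0 = 0\<close>, so the integral of \<open>t * q' t\<close> over a
  full turn is \<open>q 1 = G z\<close>. The kernel \<open>t\<close> is bounded, which makes this an integral form of the
  Wirtinger inequality.\<close>

lemma entire_eq_weighted_circle_mean_deriv:
  assumes G: "\<And>z. (G has_field_derivative H z) (at z)" and G0: "G 0 = 0"
  shows "((\<lambda>t. of_real t * (2 * of_real pi * \<i>) * exp (2 * of_real pi * \<i> * of_real t) *
            (z * H (z * exp (2 * of_real pi * \<i> * of_real t)))) has_integral G z) {0..1}"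
proof -
  let ?e = "\<lambda>t::complex. exp (2 * of_real pi * \<i> * t) :: complex"
  let ?D = "\<lambda>t. G (z * ?e t) + t * (H (z * ?e t) * (z * (?e t * (2 * of_real pi * \<i>))))"
  have "((\<lambda>t. t * G (z * ?e t)) has_field_derivative ?D t) (at t)" for t
    by (auto intro!: derivative_eq_intros DERIV_chain2[OF G])
  then have "((\<lambda>t. of_real t * G (z * ?e (of_real t))) has_vector_derivative ?D (of_real t)) (at t within {0..1})"
    for t :: real
    using has_vector_derivative_real_field[of "\<lambda>t. t * G (z * ?e t)" "?D (of_real t)" t "{0..1}"] by blast
  then have "((\<lambda>t. ?D (of_real t)) has_integral
      of_real 1 * G (z * ?e (of_real 1)) - of_real 0 * G (z * ?e (of_real 0))) {0..1::real}"
    by (intro fundamental_theorem_of_calculus) auto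
  then have "((\<lambda>t. ?D (of_real t)) has_integral G z) {0..1::real}"
    by (simp add: exp_two_pi_i')
  moreover have "((\<lambda>t. G (z * ?e (of_real t))) has_integral 0) {0..1::real}"
    using entire_circle_mean[of G 0 z] G G0 holomorphic_on_open[of UNIV G] by auto
  ultimately show ?thesis
    by (drule_tac has_integral_diff) (auto simp: mult_ac)
qed

section \<open>Entire functions of Gaussian growth\<close>

lemma exp_half_squared: "(exp (x / 2))\<^sup>2 = exp (x::real)"
  by (simp add: power2_eq_square exp_add[symmetric])

text \<open>With \<open>t = r^n * \<bar>q z0\<bar>\<close> the function \<open>h * exp (t * r^n * u * q)\<close>, where \<open>u\<close> is the phase that makes
  \<open>u * q z0\<close> nonnegative, has modulus \<open>\<bar>h z0\<bar> * exp (t\<^sup>2)\<close> at \<open>z0\<close>. On the circle \<open>r^n * \<bar>q\<bar>\<close> equals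
  \<open>\<bar>\<phi> - T\<bar>\<close>, so the exponent is at most \<open>t * (\<bar>\<phi>\<bar> + K) \<le> t\<^sup>2 / 2 + \<bar>\<phi>\<bar>\<^sup>2 / 2 + t * K\<close>, and the
  growth condition on \<open>h\<close> absorbs \<open>\<bar>\<phi>\<bar>\<^sup>2 / 2\<close>. Comparing centre and circle leaves \<open>t\<^sup>2 / 2\<close> on the left.\<close>

lemma gaussian_growth_remainder_bound:
  fixes h \<phi> T q :: "complex \<Rightarrow> complex"
  assumes h: "h holomorphic_on UNIV" and q: "q holomorphic_on UNIV"
    and split: "\<And>z. \<phi> z = T z + (z - z0) ^ n * q z"
    and bound: "\<And>z. (cmod (h z))\<^sup>2 * exp ((cmod (\<phi> z))\<^sup>2 - (cmod z)\<^sup>2) \<le> M"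
    and h0: "h z0 \<noteq> 0"
    and r: "r > 0" and T: "\<And>z. cmod (z - z0) = r \<Longrightarrow> cmod (T z) \<le> K"
  shows "(r ^ n * cmod (q z0))\<^sup>2 / 2
     \<le> (cmod z0 + r)\<^sup>2 / 2 + r ^ n * cmod (q z0) * K + ln (sqrt M / cmod (h z0))"
proof -
  define t where "t = r ^ n * cmod (q z0)"
  define u where "u = cnj (sgn (q z0))"
  define F where "F = (\<lambda>z. h z * exp (of_real (t * r ^ n) * u * q z))"
  have t: "t \<ge> 0"
    using r by (simp add: t_def)
  have "0 < (cmod (h z0))\<^sup>2 * exp ((cmod (\<phi> z0))\<^sup>2 - (cmod z0)\<^sup>2)"
    using h0 by simp
  then have M: "M > 0"
    using bound[of z0] by linarith
  have u: "cmod u \<le> 1"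
    by (auto simp: u_def norm_sgn)
  have "u * q z0 = of_real (cmod (q z0))"
    using complex_norm_square[of "q z0"]
    by (cases "q z0 = 0") (auto simp: u_def sgn_eq power2_eq_square field_simps)
  then have "of_real (t * r ^ n) * u * q z0 = of_real (t * r ^ n) * of_real (cmod (q z0))"
    by (simp only: mult.assoc)
  also have "\<dots> = of_real (t * t)"
    by (simp add: t_def)
  finally have F0: "cmod (F z0) = cmod (h z0) * exp (t * t)"
    by (simp only: F_def norm_mult norm_exp_eq_Re Re_complex_of_real)
  have circle: "cmod (F z) \<le> sqrt M * exp ((cmod z0 + r)\<^sup>2 / 2 + t\<^sup>2 / 2 + t * K)"
    if z: "cmod (z0 - z) = r" for z
  proof -
    have rz: "cmod (z - z0) = r"
      using z by (simp add: norm_minus_commute)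
    have "cmod (of_real (t * r ^ n) * u * q z) = t * cmod u * cmod ((z - z0) ^ n * q z)"
      using t r rz by (simp add: norm_mult norm_power)
    also have "\<dots> \<le> t * 1 * (cmod (\<phi> z) + K)"
    proof (intro mult_mono mult_left_mono u t)
      have "cmod ((z - z0) ^ n * q z) = cmod (\<phi> z - T z)"
        by (simp add: split)
      also have "\<dots> \<le> cmod (\<phi> z) + K"
        using norm_triangle_ineq4[of "\<phi> z" "T z"] T[OF rz] by linarith
      finally show "cmod ((z - z0) ^ n * q z) \<le> cmod (\<phi> z) + K" .
    qed (use t in auto)
    also have "\<dots> \<le> t\<^sup>2 / 2 + (cmod (\<phi> z))\<^sup>2 / 2 + t * K"
      using sum_squares_bound[of t "cmod (\<phi> z)"] by (simp add: algebra_simps)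
    finally have "Re (of_real (t * r ^ n) * u * q z) \<le> t\<^sup>2 / 2 + (cmod (\<phi> z))\<^sup>2 / 2 + t * K"
      by (rule order_trans[OF complex_Re_le_cmod])
    moreover have "cmod (h z) \<le> sqrt M * exp (((cmod z)\<^sup>2 - (cmod (\<phi> z))\<^sup>2) / 2)"
    proof -
      have "(cmod (h z))\<^sup>2 \<le> M * exp ((cmod z)\<^sup>2 - (cmod (\<phi> z))\<^sup>2)"
        using mult_right_mono[OF bound[of z], of "exp ((cmod z)\<^sup>2 - (cmod (\<phi> z))\<^sup>2)"]
        by (simp add: mult.assoc exp_add[symmetric])
      also have "\<dots> = (sqrt M * exp (((cmod z)\<^sup>2 - (cmod (\<phi> z))\<^sup>2) / 2))\<^sup>2"
        using M by (simp add: power_mult_distrib exp_half_squared)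
      finally show ?thesis
        by (rule power2_le_imp_le) (use M in simp)
    qed
    ultimately have "cmod (F z) \<le> sqrt M * exp (((cmod z)\<^sup>2 - (cmod (\<phi> z))\<^sup>2) / 2)
        * exp (t\<^sup>2 / 2 + (cmod (\<phi> z))\<^sup>2 / 2 + t * K)"
      unfolding F_def norm_mult norm_exp_eq_Re
      using M by (intro mult_mono) auto
    also have "\<dots> = sqrt M * exp ((cmod z)\<^sup>2 / 2 + t\<^sup>2 / 2 + t * K)"
      by (simp add: mult.assoc exp_add[symmetric] diff_divide_distrib)
    also have "\<dots> \<le> sqrt M * exp ((cmod z0 + r)\<^sup>2 / 2 + t\<^sup>2 / 2 + t * K)"
    proof -
      have "cmod z \<le> cmod z0 + r"
        using norm_triangle_ineq[of z0 "z - z0"] rz by simp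
      then show ?thesis
        using M by (intro mult_left_mono) (auto intro: power_mono)
    qed
    finally show ?thesis .
  qed
  have "F holomorphic_on UNIV"
    unfolding F_def by (intro holomorphic_intros h q)
  then have "F holomorphic_on ball z0 r" "continuous_on (cball z0 r) F"
    by (auto intro: holomorphic_on_subset holomorphic_on_imp_continuous_on)
  from Cauchy_inequality[OF this r circle, of 0]
  have "cmod (h z0) * exp (t * t) \<le> sqrt M * exp ((cmod z0 + r)\<^sup>2 / 2 + t\<^sup>2 / 2 + t * K)"
    by (simp add: F0)
  then have "exp (t * t) \<le> exp (ln (sqrt M / cmod (h z0))) * exp ((cmod z0 + r)\<^sup>2 / 2 + t\<^sup>2 / 2 + t * K)"
    using h0 M by (simp add: field_simps)
  then have "t * t \<le> ln (sqrt M / cmod (h z0)) + ((cmod z0 + r)\<^sup>2 / 2 + t\<^sup>2 / 2 + t * K)"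
    by (simp only: exp_add[symmetric] exp_le_cancel_iff)
  then show ?thesis
    by (simp add: t_def[symmetric] power2_eq_square)
qed

lemma entire_divide_difference:
  assumes "f holomorphic_on UNIV"
  obtains q where "q holomorphic_on UNIV" "\<And>z. f z = f a + (z - a) * q z"
proof
  show "(\<lambda>z. if z = a then deriv f a else (f z - f a) / (z - a)) holomorphic_on UNIV"
    using assms by (intro pole_lemma) auto
qed auto

text \<open>The remainder bound is used with \<open>n = 2\<close> at every point where \<open>h\<close> is nonzero, which kills the second
  derivative there, and then once with \<open>n = 1\<close> for the slope.\<close>

lemma gaussian_growth_imp_affine:
  fixes h \<phi> :: "complex \<Rightarrow> complex"
  assumes h: "h holomorphic_on UNIV" and \<phi>: "\<phi> holomorphic_on UNIV"
    and bound: "\<And>z. (cmod (h z))\<^sup>2 * exp ((cmod (\<phi> z))\<^sup>2 - (cmod z)\<^sup>2) \<le> M"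
    and nz: "\<exists>z. h z \<noteq> 0"
  shows "\<exists>A B. (\<forall>z. \<phi> z = A * z + B) \<and> cmod A \<le> 1"
proof -
  have deriv2_0: "deriv (deriv \<phi>) a = 0" if a: "h a \<noteq> 0" for a
  proof -
    obtain p where p: "p holomorphic_on UNIV" "\<And>z. \<phi> z = \<phi> a + (z - a) * p z"
      using entire_divide_difference[OF \<phi>, of a] by blast
    obtain q where q: "q holomorphic_on UNIV" "\<And>z. p z = p a + (z - a) * q z"
      using entire_divide_difference[OF p(1), of a] by blast
    define L where "L = ln (sqrt M / cmod (h a))"
    \<comment> \<open>Here \<open>q a\<close> is half the second derivative of \<open>\<phi>\<close> at \<open>a\<close>.\<close>
    have split: "\<phi> z = (\<phi> a + (z - a) * p a) + (z - a)\<^sup>2 * q z" for z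
      using p(2)[of z] q(2)[of z] by (simp add: algebra_simps power2_eq_square)
    have *: "(r\<^sup>2 * cmod (q a))\<^sup>2 / 2
        \<le> (cmod a + r)\<^sup>2 / 2 + r\<^sup>2 * cmod (q a) * (cmod (\<phi> a) + r * cmod (p a)) + L"
      if "r > 0" for r
      unfolding L_def
      by (rule gaussian_growth_remainder_bound[OF h q(1) split bound a that])
         (metis norm_mult norm_triangle_ineq)
    have **: "(cmod (q a))\<^sup>2 / 2
        \<le> ((cmod a + r)\<^sup>2 / 2 + r\<^sup>2 * cmod (q a) * (cmod (\<phi> a) + r * cmod (p a)) + L) / r ^ 4"
      if "r > 0" for r
    proof -
      have "(cmod (q a))\<^sup>2 / 2 * r ^ 4 = (r\<^sup>2 * cmod (q a))\<^sup>2 / 2"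
        by (simp add: power_mult_distrib flip: power_mult)
      with *[OF that] that show ?thesis
        by (simp only: pos_le_divide_eq zero_less_power)
    qed
    have "eventually (\<lambda>r. (cmod (q a))\<^sup>2 / 2
        \<le> ((cmod a + r)\<^sup>2 / 2 + r\<^sup>2 * cmod (q a) * (cmod (\<phi> a) + r * cmod (p a)) + L) / r ^ 4) at_top"
      using eventually_gt_at_top[of 0] by eventually_elim (rule **)
    moreover have "((\<lambda>r. ((cmod a + r)\<^sup>2 / 2 + r\<^sup>2 * cmod (q a) * (cmod (\<phi> a) + r * cmod (p a)) + L) / r ^ 4)
        \<longlongrightarrow> 0) at_top"
      by real_asymp
    ultimately have "(cmod (q a))\<^sup>2 / 2 \<le> 0"
      by (intro tendsto_lowerbound) auto
    then have q0: "q a = 0"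
      by simp
    have der: "(q has_field_derivative deriv q z) (at z)" for z
      using q(1) by (simp add: holomorphic_derivI)
    have der2: "(deriv q has_field_derivative deriv (deriv q) z) (at z)" for z
      by (rule holomorphic_derivI[OF holomorphic_deriv[OF q(1) open_UNIV] open_UNIV UNIV_I])
    have "((\<lambda>z. (\<phi> a + (z - a) * p a) + (z - a)\<^sup>2 * q z)
        has_field_derivative p a + (2 * (z - a) * q z + (z - a)\<^sup>2 * deriv q z)) (at z)" for z
      by (rule derivative_eq_intros der refl | simp)+
    then have "deriv \<phi> = (\<lambda>z. p a + (2 * (z - a) * q z + (z - a)\<^sup>2 * deriv q z))"
      unfolding split[symmetric] by (intro ext DERIV_imp_deriv)
    moreover have "((\<lambda>z. p a + (2 * (z - a) * q z + (z - a)\<^sup>2 * deriv q z))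
        has_field_derivative 0) (at a)"
      by (rule derivative_eq_intros der der2 refl | simp add: q0)+
    ultimately show ?thesis
      by (metis DERIV_imp_deriv)
  qed
  obtain z0 where z0: "h z0 \<noteq> 0"
    using nz by blast
  have open_nz: "open {z. h z \<noteq> 0}"
    using h by (intro open_Collect_neq holomorphic_on_imp_continuous_on continuous_on_const)
  have dd: "deriv (deriv \<phi>) holomorphic_on UNIV"
    by (intro holomorphic_deriv \<phi> open_UNIV)
  have deriv2: "deriv (deriv \<phi>) z = 0" for z
    by (rule analytic_continuation_open[OF open_nz open_UNIV _ connected_UNIV subset_UNIV dd])
       (use z0 deriv2_0 in simp_all, blast)
  have "(deriv \<phi> has_field_derivative 0) (at z)" for z
    using holomorphic_derivI[OF holomorphic_deriv[OF \<phi> open_UNIV] open_UNIV UNIV_I, of z]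
    by (simp only: deriv2)
  then have "\<exists>A. \<forall>z\<in>UNIV. deriv \<phi> z = A"
    by (intro has_field_derivative_zero_constant) auto
  then obtain A where A: "\<And>z. deriv \<phi> z = A"
    by blast
  have "((\<lambda>z. \<phi> z - A * z) has_field_derivative A - A * 1) (at z)" for z
    by (intro DERIV_diff DERIV_cmult DERIV_ident holomorphic_derivI[OF \<phi> open_UNIV UNIV_I, of z, unfolded A])
  then have "\<exists>B. \<forall>z\<in>UNIV. \<phi> z - A * z = B"
    by (intro has_field_derivative_zero_constant) auto
  then obtain B where "\<And>z. \<phi> z - A * z = B"
    by blast
  then have AB: "\<phi> z = A * z + B" for z
    by (metis diff_add_cancel add.commute)
  define L where "L = ln (sqrt M / cmod (h z0))"
  have **: "(r ^ 1 * cmod A)\<^sup>2 / 2 \<le> (cmod z0 + r)\<^sup>2 / 2 + r ^ 1 * cmod A * cmod (\<phi> z0) + L"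
    if "r > 0" for r
    unfolding L_def
  proof (rule gaussian_growth_remainder_bound[OF h holomorphic_on_const _ bound z0 that])
    show "\<phi> z = \<phi> z0 + (z - z0) ^ 1 * A" for z
      unfolding AB by (simp only: power_one_right left_diff_distrib) (simp only: mult.commute, simp)
  qed simp
  have *: "(cmod A)\<^sup>2 / 2
      \<le> ((cmod z0 + r)\<^sup>2 / 2 + r * cmod A * cmod (\<phi> z0) + L) / r\<^sup>2" if "r > 0" for r
  proof -
    have "(cmod A)\<^sup>2 / 2 * r\<^sup>2 = (r ^ 1 * cmod A)\<^sup>2 / 2"
      by (simp add: power_mult_distrib)
    with **[OF that] that show ?thesis
      by (simp only: pos_le_divide_eq zero_less_power power_one_right)
  qed
  have "eventually (\<lambda>r. (cmod A)\<^sup>2 / 2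
      \<le> ((cmod z0 + r)\<^sup>2 / 2 + r * cmod A * cmod (\<phi> z0) + L) / r\<^sup>2) at_top"
    using eventually_gt_at_top[of 0] by eventually_elim (rule *)
  moreover have "((\<lambda>r. ((cmod z0 + r)\<^sup>2 / 2 + r * cmod A * cmod (\<phi> z0) + L) / r\<^sup>2) \<longlongrightarrow> 1 / 2) at_top"
    by real_asymp
  ultimately have "(cmod A)\<^sup>2 / 2 \<le> 1 / 2"
    by (intro tendsto_lowerbound) auto
  then have "(cmod A)\<^sup>2 \<le> 1\<^sup>2"
    by simp
  then have "cmod A \<le> 1"
    by (rule power2_le_imp_le) simp
  with AB show ?thesis
    by blast
qed

section \<open>Gaussian energy of entire functions\<close>

text \<open>This is \<open>\<pi>\<close> times the squared Fock norm, but with values in the extended reals: functions not yet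
  known to lie in the Fock space can be estimated, and membership read off afterwards.\<close>

definition gauss_energy :: "(complex \<Rightarrow> complex) \<Rightarrow> ennreal" where
  "gauss_energy F = (\<integral>\<^sup>+z. ennreal ((cmod (F z))\<^sup>2 * fock_weight z) \<partial>lborel)"

lemma entire_borel_measurable:
  "F holomorphic_on UNIV \<Longrightarrow> F \<in> borel_measurable borel"
  by (intro borel_measurable_continuous_onI holomorphic_on_imp_continuous_on)

lemma fock_weight_measurable [measurable]: "fock_weight \<in> borel_measurable borel"
  by (intro borel_measurable_continuous_onI continuous_on_fock_weight)

lemma gauss_energy_cmult:
  assumes "F holomorphic_on UNIV"
  shows "gauss_energy (\<lambda>z. c * F z) = ennreal ((cmod c)\<^sup>2) * gauss_energy F"
proof -
  note [measurable] = entire_borel_measurable[OF assms]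
  show ?thesis
    unfolding gauss_energy_def
    by (subst nn_integral_cmult[symmetric])
       (auto simp: norm_mult power_mult_distrib mult.assoc fock_weight_pos less_imp_le
          simp flip: ennreal_mult)
qed

lemma fock_entire: "fock_fun f holomorphic_on UNIV"
  using fock_fun[of f] by (simp add: fock_set_def)

lemma gauss_energy_fock_fun: "gauss_energy (fock_fun f) = ennreal (pi * (norm f)\<^sup>2)"
proof -
  have int: "integrable lborel (\<lambda>z. (cmod (fock_fun f z))\<^sup>2 * fock_weight z)"
    using fock_fun[of f] by (simp add: fock_set_def)
  have "f \<bullet> f = 1 / pi * (LINT z|lborel. (cmod (fock_fun f z))\<^sup>2 * fock_weight z)"
    unfolding inner_fock_def fock_inner_self by (rule Re_complex_of_real)
  then have "pi * (norm f)\<^sup>2 = (LINT z|lborel. (cmod (fock_fun f z))\<^sup>2 * fock_weight z)"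
    by (simp add: power2_norm_eq_inner)
  then show ?thesis
    unfolding gauss_energy_def
    using nn_integral_eq_integral[OF int] by (simp add: fock_weight_pos less_imp_le)
qed

lemma fock_set_if_gauss_energy_finite:
  assumes "F holomorphic_on UNIV" "gauss_energy F < \<infinity>"
  shows "F \<in> fock_set"
proof -
  note [measurable] = entire_borel_measurable[OF assms(1)]
  have "integrable lborel (\<lambda>z. (cmod (F z))\<^sup>2 * fock_weight z)"
    using assms(2) unfolding gauss_energy_def
    by (intro integrableI_bounded) (auto simp: abs_mult fock_weight_pos less_imp_le)
  with assms(1) show ?thesis
    by (simp add: fock_set_def)
qed

lemma norm_fock_le_if_gauss_energy_le:
  assumes "gauss_energy (fock_fun g) \<le> ennreal (C\<^sup>2) * gauss_energy (fock_fun f)" "C \<ge> 0"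
  shows "norm g \<le> C * norm f"
proof -
  have "ennreal (pi * (norm g)\<^sup>2) \<le> ennreal (C\<^sup>2 * (pi * (norm f)\<^sup>2))"
    using assms(1) unfolding gauss_energy_fock_fun
    by (subst ennreal_mult) (auto intro: mult_nonneg_nonneg)
  then have "pi * (norm g)\<^sup>2 \<le> C\<^sup>2 * (pi * (norm f)\<^sup>2)"
    by (subst (asm) ennreal_le_iff) auto
  also have "\<dots> = pi * (C * norm f)\<^sup>2"
    by (simp only: power_mult_distrib mult.left_commute)
  finally have "(norm g)\<^sup>2 \<le> (C * norm f)\<^sup>2"
    by (rule mult_left_le_imp_le) (rule pi_gt_zero)
  then show ?thesis
    by (rule power2_le_imp_le) (rule mult_nonneg_nonneg[OF assms(2) norm_ge_zero])
qed

text \<open>By the mean value property and Cauchy-Schwarz, \<open>\<bar>F w\<bar>\<^sup>2\<close> is at most its average over the unit disc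
  about \<open>w\<close>, and the Gaussian weight is bounded below on that disc.\<close>

lemma gauss_energy_point_evaluation:
  obtains C where "C \<ge> 0"
    "\<And>F w. F holomorphic_on UNIV \<Longrightarrow> cmod w \<le> R \<Longrightarrow>
      ennreal ((cmod (F w))\<^sup>2) \<le> ennreal C * gauss_energy F"
proof -
  define v where "v = measure lborel (ball (0::complex) 1)"
  have v: "emeasure lborel (ball (0::complex) 1) = ennreal v"
    using emeasure_lborel_ball_finite[of "0::complex" 1] unfolding v_def
    by (intro emeasure_eq_ennreal_measure) auto
  have v_pos: "v > 0"
    unfolding v_def by (simp add: content_ball_pos)
  let ?e = "\<lambda>t::real. exp (2 * of_real pi * \<i> * of_real t) :: complex"
  define C where "C = exp ((R + 1)\<^sup>2) / v"
  show ?thesis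
  proof (rule that[of C])
    show "C \<ge> 0"
      using v_pos by (simp add: C_def)
    fix F :: "complex \<Rightarrow> complex" and w
    assume F: "F holomorphic_on UNIV" and w: "cmod w \<le> R"
    note [measurable] = entire_borel_measurable[OF F]
    \<comment> \<open>Cutting off by a disc about the origin is compatible with rotations.\<close>
    define K where "K = (\<lambda>z. ennreal ((cmod (F (w + z)))\<^sup>2) * indicator (ball 0 1) z)"
    have [measurable]: "ball (0::complex) 1 \<in> sets borel"
      by simp
    have [measurable]: "K \<in> borel_measurable borel"
      unfolding K_def by measurable
    have mean: "ennreal ((cmod (F w))\<^sup>2) * indicator (ball 0 1) z
        \<le> (\<integral>\<^sup>+t. K (z * ?e t) * indicator {0..1} t \<partial>lborel)" for z
    proof (cases "z \<in> ball 0 1")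
      case True
      have "continuous_on {0..1} (\<lambda>t. F (w + z * ?e t))"
        by (intro continuous_on_compose2[OF holomorphic_on_imp_continuous_on[OF F]] continuous_intros) auto
      from norm_integral_power2_le_nn_integral[OF this]
      have "ennreal ((cmod (F w))\<^sup>2)
          \<le> (\<integral>\<^sup>+t. ennreal ((cmod (F (w + z * ?e t)))\<^sup>2) * indicator {0..1} t \<partial>lborel)"
        by (simp add: integral_unique[OF entire_circle_mean[OF F]])
      then show ?thesis
        using True by (simp add: K_def norm_mult)
    qed simp
    have K_le: "K z \<le> ennreal (exp ((R + 1)\<^sup>2)) * ennreal ((cmod (F (z + w)))\<^sup>2 * fock_weight (z + w))" for z
    proof (cases "z \<in> ball 0 1")
      case True
      have "cmod (z + w) \<le> R + 1"
        using True w norm_triangle_ineq[of z w] by simp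
      then have "(cmod (z + w))\<^sup>2 \<le> (R + 1)\<^sup>2"
        by (intro power_mono) auto
      then have "1 \<le> exp ((R + 1)\<^sup>2) * fock_weight (z + w)"
        by (simp add: fock_weight_def exp_add[symmetric])
      then have "1 * (cmod (F (z + w)))\<^sup>2 \<le> exp ((R + 1)\<^sup>2) * fock_weight (z + w) * (cmod (F (z + w)))\<^sup>2"
        by (intro mult_right_mono) auto
      then have "(cmod (F (z + w)))\<^sup>2 \<le> exp ((R + 1)\<^sup>2) * ((cmod (F (z + w)))\<^sup>2 * fock_weight (z + w))"
        by (simp add: mult_ac)
      then have "ennreal ((cmod (F (z + w)))\<^sup>2)
          \<le> ennreal (exp ((R + 1)\<^sup>2)) * ennreal ((cmod (F (z + w)))\<^sup>2 * fock_weight (z + w))"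
        by (subst ennreal_mult'[symmetric]) (auto intro: ennreal_leI)
      then show ?thesis
        using True by (simp add: K_def add.commute)
    qed (simp add: K_def)
    have "ennreal v * ennreal ((cmod (F w))\<^sup>2)
        = (\<integral>\<^sup>+z. ennreal ((cmod (F w))\<^sup>2) * indicator (ball (0::complex) 1) z \<partial>lborel)"
      by (subst nn_integral_cmult) (auto simp: v mult.commute)
    also have "\<dots> \<le> (\<integral>\<^sup>+z. \<integral>\<^sup>+t. K (z * ?e t) * indicator {0..1} t \<partial>lborel \<partial>lborel)"
      by (intro nn_integral_mono mean)
    also have "\<dots> = (\<integral>\<^sup>+z. K z \<partial>lborel)"
      by (rule nn_integral_rotation_average) measurable
    also have "\<dots> \<le> (\<integral>\<^sup>+z. ennreal (exp ((R + 1)\<^sup>2)) * ennreal ((cmod (F (z + w)))\<^sup>2 * fock_weight (z + w)) \<partial>lborel)"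
      by (intro nn_integral_mono K_le)
    also have "\<dots> = ennreal (exp ((R + 1)\<^sup>2)) * gauss_energy F"
      using nn_integral_complex_affine[of "\<lambda>z. ennreal ((cmod (F z))\<^sup>2 * fock_weight z)" 1 w]
      by (simp add: gauss_energy_def nn_integral_cmult)
    finally have "ennreal (1 / v) * (ennreal v * ennreal ((cmod (F w))\<^sup>2))
        \<le> ennreal (1 / v) * (ennreal (exp ((R + 1)\<^sup>2)) * gauss_energy F)"
      by (rule mult_left_mono) simp
    then show "ennreal ((cmod (F w))\<^sup>2) \<le> ennreal C * gauss_energy F"
      using v_pos unfolding C_def mult.assoc[symmetric]
      by (subst (asm) (1 2) ennreal_mult[symmetric]) simp_all
  qed
qed

text \<open>A Hardy inequality: the integral form of the Wirtinger inequality holds on every circle about the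
  origin with the same constant, and a radial weight is constant on each of them. Allowing every
  radial \<open>W\<close>, not just the Gaussian, is what lets the inequality be iterated.\<close>

lemma radial_energy_primitive_le:
  fixes W :: "real \<Rightarrow> ennreal"
  assumes H: "H holomorphic_on UNIV" and G: "\<And>z. (G has_field_derivative H z) (at z)"
    and G0: "G 0 = 0" and [measurable]: "W \<in> borel_measurable borel"
  shows "(\<integral>\<^sup>+z. ennreal ((cmod (G z))\<^sup>2) * W (cmod z) \<partial>lborel)
       \<le> ennreal ((2 * pi)\<^sup>2) * (\<integral>\<^sup>+z. ennreal ((cmod (z * H z))\<^sup>2) * W (cmod z) \<partial>lborel)"
proof -
  note [measurable] = entire_borel_measurable[OF H]
  let ?e = "\<lambda>t::real. exp (2 * of_real pi * \<i> * of_real t) :: complex"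
  define K where "K = (\<lambda>z. ennreal ((cmod (z * H z))\<^sup>2) * W (cmod z))"
  have [measurable]: "K \<in> borel_measurable borel"
    unfolding K_def by measurable
  have "ennreal ((cmod (G z))\<^sup>2) * W (cmod z)
      \<le> ennreal ((2 * pi)\<^sup>2) * (\<integral>\<^sup>+t. K (z * ?e t) * indicator {0..1} t \<partial>lborel)" for z
  proof -
    let ?k = "\<lambda>t. of_real t * (2 * of_real pi * \<i>) * ?e t * (z * H (z * ?e t))"
    have "continuous_on {0..1} ?k"
      by (intro continuous_intros continuous_on_compose2[OF holomorphic_on_imp_continuous_on[OF H]]) auto
    from norm_integral_power2_le_nn_integral[OF this]
    have "ennreal ((cmod (G z))\<^sup>2) \<le> (\<integral>\<^sup>+t. ennreal ((cmod (?k t))\<^sup>2) * indicator {0..1} t \<partial>lborel)"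
      by (simp only: integral_unique[OF entire_eq_weighted_circle_mean_deriv[OF G G0]])
    also have "\<dots> \<le> (\<integral>\<^sup>+t. ennreal ((2 * pi)\<^sup>2) *
        (ennreal ((cmod (z * ?e t * H (z * ?e t)))\<^sup>2) * indicator {0..1} t) \<partial>lborel)"
    proof (intro nn_integral_mono)
      fix t :: real
      show "ennreal ((cmod (?k t))\<^sup>2) * indicator {0..1} t \<le> ennreal ((2 * pi)\<^sup>2) *
        (ennreal ((cmod (z * ?e t * H (z * ?e t)))\<^sup>2) * indicator {0..1} t)"
      proof (cases "t \<in> {0..1}")
        case True
        have "(cmod (?k t))\<^sup>2 = t\<^sup>2 * ((2 * pi)\<^sup>2 * (cmod (z * ?e t * H (z * ?e t)))\<^sup>2)"
          by (simp add: norm_mult power_mult_distrib mult_ac)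
        also have "\<dots> \<le> (2 * pi)\<^sup>2 * (cmod (z * ?e t * H (z * ?e t)))\<^sup>2"
          using True by (intro mult_left_le_one_le) (auto simp: power_le_one)
        finally show ?thesis
          using True by (simp add: ennreal_leI flip: ennreal_mult)
      qed simp
    qed
    also have "\<dots> = ennreal ((2 * pi)\<^sup>2) *
        (\<integral>\<^sup>+t. ennreal ((cmod (z * ?e t * H (z * ?e t)))\<^sup>2) * indicator {0..1} t \<partial>lborel)"
      by (rule nn_integral_cmult) measurable
    finally have "ennreal ((cmod (G z))\<^sup>2) * W (cmod z) \<le> ennreal ((2 * pi)\<^sup>2) *
        (\<integral>\<^sup>+t. ennreal ((cmod (z * ?e t * H (z * ?e t)))\<^sup>2) * indicator {0..1} t \<partial>lborel) * W (cmod z)"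
      by (rule mult_right_mono) simp
    also have "\<dots> = ennreal ((2 * pi)\<^sup>2) *
        (\<integral>\<^sup>+t. ennreal ((cmod (z * ?e t * H (z * ?e t)))\<^sup>2) * indicator {0..1} t * W (cmod z) \<partial>lborel)"
      by (subst nn_integral_multc) (auto simp: mult.assoc)
    also have "\<dots> = ennreal ((2 * pi)\<^sup>2) * (\<integral>\<^sup>+t. K (z * ?e t) * indicator {0..1} t \<partial>lborel)"
      by (simp add: K_def norm_mult mult_ac)
    finally show ?thesis .
  qed
  then have "(\<integral>\<^sup>+z. ennreal ((cmod (G z))\<^sup>2) * W (cmod z) \<partial>lborel)
      \<le> (\<integral>\<^sup>+z. ennreal ((2 * pi)\<^sup>2) * (\<integral>\<^sup>+t. K (z * ?e t) * indicator {0..1} t \<partial>lborel) \<partial>lborel)"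
    by (rule nn_integral_mono)
  also have "\<dots> = ennreal ((2 * pi)\<^sup>2) * (\<integral>\<^sup>+z. \<integral>\<^sup>+t. K (z * ?e t) * indicator {0..1} t \<partial>lborel \<partial>lborel)"
    by (rule nn_integral_cmult) measurable
  also have "(\<integral>\<^sup>+z. \<integral>\<^sup>+t. K (z * ?e t) * indicator {0..1} t \<partial>lborel \<partial>lborel) = (\<integral>\<^sup>+z. K z \<partial>lborel)"
    by (rule nn_integral_rotation_average) measurable
  finally show ?thesis
    by (simp add: K_def)
qed

text \<open>In effect \<open>G\<close> is \<open>g\<close> minus its Taylor polynomial at \<open>0\<close> of degree below \<open>m\<close>. The induction first
  treats \<open>deriv g\<close> with the weight \<open>r\<^sup>2 * W r\<close>, which is the weight that the Hardy inequality for the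
  last primitive asks for.\<close>

lemma radial_energy_higher_primitive:
  fixes W :: "real \<Rightarrow> ennreal"
  assumes "g holomorphic_on UNIV" and "W \<in> borel_measurable borel"
  shows "\<exists>G. G holomorphic_on UNIV \<and> (deriv ^^ m) G = (deriv ^^ m) g \<and>
    (\<integral>\<^sup>+z. ennreal ((cmod (G z))\<^sup>2) * W (cmod z) \<partial>lborel)
    \<le> ennreal ((2 * pi) ^ (2 * m)) *
        (\<integral>\<^sup>+z. ennreal ((cmod (z ^ m * (deriv ^^ m) g z))\<^sup>2) * W (cmod z) \<partial>lborel)"
  using assms
proof (induction m arbitrary: g W)
  case 0
  then show ?case
    by (intro exI[of _ g]) auto
next
  case (Suc m)
  note [measurable] = Suc.prems(2)
  \<comment> \<open>The extra weight \<open>r\<^sup>2\<close> supplies the factor \<open>z\<close> in the Hardy inequality for the primitive of \<open>H\<close>.\<close>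
  have "deriv g holomorphic_on UNIV" "(\<lambda>r. ennreal (r\<^sup>2) * W r) \<in> borel_measurable borel"
    using Suc.prems by (auto intro: holomorphic_deriv)
  from Suc.IH[OF this] obtain H where H: "H holomorphic_on UNIV"
    and deriv_H: "(deriv ^^ m) H = (deriv ^^ m) (deriv g)"
    and le: "(\<integral>\<^sup>+z. ennreal ((cmod (H z))\<^sup>2) * (ennreal ((cmod z)\<^sup>2) * W (cmod z)) \<partial>lborel)
      \<le> ennreal ((2 * pi) ^ (2 * m)) *
        (\<integral>\<^sup>+z. ennreal ((cmod (z ^ m * (deriv ^^ m) (deriv g) z))\<^sup>2) * (ennreal ((cmod z)\<^sup>2) * W (cmod z)) \<partial>lborel)"
    by blast
  obtain P where P: "\<And>z. (P has_field_derivative H z) (at z)"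
    using holomorphic_convex_primitive'[OF _ _ H] by auto
  define G where "G = (\<lambda>z. P z - P 0)"
  have G: "(G has_field_derivative H z) (at z)" for z
    unfolding G_def by (auto intro!: derivative_eq_intros P)
  have "deriv G = H"
    using G by (auto intro: DERIV_imp_deriv)
  then have deriv_G: "(deriv ^^ Suc m) G = (deriv ^^ Suc m) g"
    by (simp only: funpow_Suc_right o_apply deriv_H)
  have "(\<integral>\<^sup>+z. ennreal ((cmod (G z))\<^sup>2) * W (cmod z) \<partial>lborel)
      \<le> ennreal ((2 * pi)\<^sup>2) * (\<integral>\<^sup>+z. ennreal ((cmod (z * H z))\<^sup>2) * W (cmod z) \<partial>lborel)"
    by (rule radial_energy_primitive_le[OF H G _ Suc.prems(2)]) (simp add: G_def)
  also have "(\<integral>\<^sup>+z. ennreal ((cmod (z * H z))\<^sup>2) * W (cmod z) \<partial>lborel)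
      = (\<integral>\<^sup>+z. ennreal ((cmod (H z))\<^sup>2) * (ennreal ((cmod z)\<^sup>2) * W (cmod z)) \<partial>lborel)"
    by (simp add: norm_mult power_mult_distrib ennreal_mult mult_ac)
  also note le
  also have "(\<integral>\<^sup>+z. ennreal ((cmod (z ^ m * (deriv ^^ m) (deriv g) z))\<^sup>2) * (ennreal ((cmod z)\<^sup>2) * W (cmod z)) \<partial>lborel)
      = (\<integral>\<^sup>+z. ennreal ((cmod (z ^ Suc m * (deriv ^^ Suc m) g z))\<^sup>2) * W (cmod z) \<partial>lborel)"
    by (simp add: norm_mult power_mult_distrib ennreal_mult mult_ac funpow_swap1)
  finally have "(\<integral>\<^sup>+z. ennreal ((cmod (G z))\<^sup>2) * W (cmod z) \<partial>lborel)
      \<le> ennreal ((2 * pi) ^ (2 * Suc m)) *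
        (\<integral>\<^sup>+z. ennreal ((cmod (z ^ Suc m * (deriv ^^ Suc m) g z))\<^sup>2) * W (cmod z) \<partial>lborel)"
    by (simp add: mult_left_mono power_add mult.assoc ennreal_mult power2_eq_square)
  moreover have "G holomorphic_on UNIV"
    using G by (auto simp: holomorphic_on_open)
  ultimately show ?case
    using deriv_G by blast
qed

text \<open>Off the unit disc about \<open>-b\<close> one has \<open>\<bar>z\<bar> \<le> (1 + \<bar>b\<bar>) * \<bar>z + b\<bar>\<close>. Inside it the factor \<open>(z + b)^m\<close> is
  small and gives no direct control of \<open>u\<close>; but on the boundary circle it has modulus one, so the
  maximum principle and the continuity of point evaluation apply.\<close>

lemma gauss_energy_recentre_power:
  obtains C where "C \<ge> 0"
    "\<And>u. u holomorphic_on UNIV \<Longrightarrow>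
      gauss_energy (\<lambda>z. z ^ m * u z) \<le> ennreal C * gauss_energy (\<lambda>z. (z + b) ^ m * u z)"
proof -
  obtain E where E: "E \<ge> 0"
    "\<And>F w. F holomorphic_on UNIV \<Longrightarrow> cmod w \<le> 1 + cmod b \<Longrightarrow>
      ennreal ((cmod (F w))\<^sup>2) \<le> ennreal E * gauss_energy F"
    using gauss_energy_point_evaluation[of "1 + cmod b"] by metis
  define v where "v = measure lborel (ball (- b) 1)"
  have v: "emeasure lborel (ball (- b) 1) = ennreal v"
    using emeasure_lborel_ball_finite[of "- b" 1] unfolding v_def
    by (intro emeasure_eq_ennreal_measure) auto
  define c where "c = ((1 + cmod b) ^ m)\<^sup>2"
  have c: "c \<ge> 0" and v_nonneg: "v \<ge> 0"
    by (simp_all add: c_def v_def)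
  show ?thesis
  proof (rule that)
    show "0 \<le> c * (1 + E * v)"
      using E(1) c v_nonneg by simp
    fix u :: "complex \<Rightarrow> complex"
    assume u: "u holomorphic_on UNIV"
    define K where "K = (\<lambda>z. (z + b) ^ m * u z)"
    have K: "K holomorphic_on UNIV"
      unfolding K_def by (intro holomorphic_intros u)
    note [measurable] = entire_borel_measurable[OF K]
    have [measurable]: "ball (- b) 1 \<in> sets borel"
      by simp
    have far: "ennreal ((cmod (z ^ m * u z))\<^sup>2 * fock_weight z)
        \<le> ennreal c * ennreal ((cmod (K z))\<^sup>2 * fock_weight z)"
      if z: "z \<notin> ball (- b) 1" for z
    proof -
      have zb: "1 \<le> cmod (z + b)"
        using z by (simp add: dist_norm norm_minus_commute add.commute)
      have "cmod z \<le> cmod (z + b) + cmod b"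
        using norm_triangle_ineq4[of "z + b" b] by simp
      also have "\<dots> \<le> cmod (z + b) + cmod b * cmod (z + b)"
        using mult_left_mono[OF zb norm_ge_zero[of b]] by simp
      also have "\<dots> = (1 + cmod b) * cmod (z + b)"
        by (simp add: distrib_right)
      finally have "cmod z ^ m \<le> ((1 + cmod b) * cmod (z + b)) ^ m"
        by (rule power_mono) simp
      then have "cmod z ^ m * cmod (u z) \<le> ((1 + cmod b) * cmod (z + b)) ^ m * cmod (u z)"
        by (rule mult_right_mono) simp
      then have "cmod (z ^ m * u z) \<le> (1 + cmod b) ^ m * cmod (K z)"
        by (simp add: K_def norm_mult norm_power power_mult_distrib mult.assoc)
      then have "(cmod (z ^ m * u z))\<^sup>2 \<le> ((1 + cmod b) ^ m * cmod (K z))\<^sup>2"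
        by (rule power_mono) simp
      also have "\<dots> = c * (cmod (K z))\<^sup>2"
        by (simp only: c_def power_mult_distrib)
      finally have "(cmod (z ^ m * u z))\<^sup>2 * fock_weight z \<le> c * (cmod (K z))\<^sup>2 * fock_weight z"
        by (rule mult_right_mono) (rule less_imp_le[OF fock_weight_pos])
      then show ?thesis
        by (subst ennreal_mult'[symmetric, OF c]) (simp only: mult.assoc ennreal_leI)
    qed
    have near: "ennreal ((cmod (z ^ m * u z))\<^sup>2 * fock_weight z)
        \<le> ennreal c * (ennreal E * gauss_energy K)"
      if z: "z \<in> ball (- b) 1" for z
    proof -
      have "compact (sphere (- b) 1)" "sphere (- b) 1 \<noteq> {}"
        by auto
      moreover have "continuous_on (sphere (- b) 1) (\<lambda>w. cmod (u w))"
        by (intro continuous_on_norm holomorphic_on_imp_continuous_on holomorphic_on_subset[OF u]) simp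
      ultimately obtain w where w: "w \<in> sphere (- b) 1"
        and max: "\<And>x. x \<in> sphere (- b) 1 \<Longrightarrow> cmod (u x) \<le> cmod (u w)"
        using continuous_attains_sup[of "sphere (- b) 1" "\<lambda>w. cmod (u w)"] by blast
      have "cmod (u z) \<le> cmod (u w)"
      proof (rule maximum_modulus_frontier[of u "ball (- b) 1"])
        show "u holomorphic_on interior (ball (- b) 1)" "continuous_on (closure (ball (- b) 1)) u"
          by (intro holomorphic_on_imp_continuous_on holomorphic_on_subset[OF u] subset_UNIV)+
        show "cmod (u x) \<le> cmod (u w)" if "x \<in> frontier (ball (- b) 1)" for x
          using that by (intro max) simp
      qed (simp_all add: z del: mem_ball)
      moreover have wb: "cmod (w + b) = 1"
        using w by (simp add: dist_norm norm_minus_commute add.commute)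
      then have "cmod (K w) = cmod (u w)"
        by (simp add: K_def norm_mult norm_power)
      ultimately have "cmod (u z) \<le> cmod (K w)"
        by simp
      moreover have "cmod z \<le> 1 + cmod b"
        using z norm_triangle_ineq4[of "z + b" b] by (simp add: dist_norm norm_minus_commute add.commute)
      ultimately have "cmod (z ^ m * u z) \<le> (1 + cmod b) ^ m * cmod (K w)"
        unfolding norm_mult norm_power by (intro mult_mono power_mono) auto
      then have "(cmod (z ^ m * u z))\<^sup>2 \<le> ((1 + cmod b) ^ m * cmod (K w))\<^sup>2"
        by (rule power_mono) simp
      also have "\<dots> = c * (cmod (K w))\<^sup>2"
        by (simp only: c_def power_mult_distrib)
      finally have le: "(cmod (z ^ m * u z))\<^sup>2 \<le> c * (cmod (K w))\<^sup>2" .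
      have "(cmod (z ^ m * u z))\<^sup>2 * fock_weight z \<le> (cmod (z ^ m * u z))\<^sup>2"
        by (rule mult_left_le) (simp_all add: fock_weight_def)
      with le have "(cmod (z ^ m * u z))\<^sup>2 * fock_weight z \<le> c * (cmod (K w))\<^sup>2"
        by linarith
      then have "ennreal ((cmod (z ^ m * u z))\<^sup>2 * fock_weight z) \<le> ennreal c * ennreal ((cmod (K w))\<^sup>2)"
        by (subst ennreal_mult'[symmetric, OF c]) (rule ennreal_leI)
      also have "cmod w \<le> 1 + cmod b"
        using wb norm_triangle_ineq4[of "w + b" b] by simp
      then have "ennreal c * ennreal ((cmod (K w))\<^sup>2) \<le> ennreal c * (ennreal E * gauss_energy K)"
        by (intro mult_left_mono E(2) K) simp_all
      finally show ?thesis .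
    qed
    have "gauss_energy (\<lambda>z. z ^ m * u z)
        \<le> (\<integral>\<^sup>+z. ennreal c * ennreal ((cmod (K z))\<^sup>2 * fock_weight z)
              + ennreal c * (ennreal E * gauss_energy K) * indicator (ball (- b) 1) z \<partial>lborel)"
      unfolding gauss_energy_def[of "\<lambda>z. z ^ m * u z"]
    proof (rule nn_integral_mono)
      fix z
      show "ennreal ((cmod (z ^ m * u z))\<^sup>2 * fock_weight z)
          \<le> ennreal c * ennreal ((cmod (K z))\<^sup>2 * fock_weight z)
            + ennreal c * (ennreal E * gauss_energy K) * indicator (ball (- b) 1) z"
        using far[of z] near[of z]
        by (cases "z \<in> ball (- b) 1") (simp_all add: add_increasing del: mem_ball)
    qed
    also have "\<dots> = ennreal c * gauss_energy K
        + ennreal c * (ennreal E * gauss_energy K) * ennreal v"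
      unfolding gauss_energy_def[of K] v[symmetric]
      by (subst nn_integral_add) (simp_all add: nn_integral_cmult)
    also have "\<dots> = ennreal (c * (1 + E * v)) * gauss_energy K"
      using c E(1) v_nonneg
      by (simp add: ennreal_mult ennreal_plus distrib_left distrib_right mult.assoc mult.commute[of "gauss_energy K"])
    finally show "gauss_energy (\<lambda>z. z ^ m * u z)
        \<le> ennreal (c * (1 + E * v)) * gauss_energy (\<lambda>z. (z + b) ^ m * u z)"
      by (simp only: K_def)
  qed
qed

text \<open>Passing from \<open>g\<close> to \<open>G\<close> subtracts a polynomial of degree below \<open>m\<close>. The centre \<open>-b\<close> is arbitrary
  because in the application \<open>z + b\<close> is a multiple of the symbol, which vanishes at \<open>-b\<close>.\<close>

lemma gauss_energy_reduce_mod_polynomials: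
  "\<exists>C\<ge>0. \<forall>g. g holomorphic_on UNIV \<longrightarrow> (\<exists>G. G holomorphic_on UNIV \<and> (deriv ^^ m) G = (deriv ^^ m) g \<and>
      gauss_energy G \<le> ennreal C * gauss_energy (\<lambda>z. (z + b) ^ m * (deriv ^^ m) g z))"
proof -
  obtain C where C: "C \<ge> 0" "\<And>u. u holomorphic_on UNIV \<Longrightarrow>
      gauss_energy (\<lambda>z. z ^ m * u z) \<le> ennreal C * gauss_energy (\<lambda>z. (z + b) ^ m * u z)"
    using gauss_energy_recentre_power[of m b] by metis
  show ?thesis
  proof (rule exI, intro conjI allI impI)
    show "0 \<le> (2 * pi) ^ (2 * m) * C"
      using C(1) by simp
    fix g :: "complex \<Rightarrow> complex"
    assume g: "g holomorphic_on UNIV"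
    have energy: "(\<integral>\<^sup>+z. ennreal ((cmod (F z))\<^sup>2) * ennreal (exp (- (cmod z)\<^sup>2)) \<partial>lborel) = gauss_energy F" for F
      unfolding gauss_energy_def fock_weight_def by (simp add: ennreal_mult')
    have "(\<lambda>r. ennreal (exp (- r\<^sup>2))) \<in> borel_measurable borel"
      by measurable
    from radial_energy_higher_primitive[OF g this, of m, unfolded energy]
    obtain G where G: "G holomorphic_on UNIV" "(deriv ^^ m) G = (deriv ^^ m) g"
      and le: "gauss_energy G \<le> ennreal ((2 * pi) ^ (2 * m)) * gauss_energy (\<lambda>z. z ^ m * (deriv ^^ m) g z)"
      by blast
    note le
    also have "ennreal ((2 * pi) ^ (2 * m)) * gauss_energy (\<lambda>z. z ^ m * (deriv ^^ m) g z)
        \<le> ennreal ((2 * pi) ^ (2 * m)) *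
        (ennreal C * gauss_energy (\<lambda>z. (z + b) ^ m * (deriv ^^ m) g z))"
      by (intro mult_left_mono C(2) holomorphic_higher_deriv[OF g open_UNIV]) simp
    also have "\<dots> = ennreal ((2 * pi) ^ (2 * m) * C) * gauss_energy (\<lambda>z. (z + b) ^ m * (deriv ^^ m) g z)"
      by (subst ennreal_mult') (simp_all add: mult.assoc)
    finally show "\<exists>G. G holomorphic_on UNIV \<and> (deriv ^^ m) G = (deriv ^^ m) g \<and>
      gauss_energy G \<le> ennreal ((2 * pi) ^ (2 * m) * C) * gauss_energy (\<lambda>z. (z + b) ^ m * (deriv ^^ m) g z)"
      using G by blast
  qed
qed

section \<open>Boundedness of the maximal operator\<close>

text \<open>The quotient norm of the class of \<open>g\<close> is at most the norm of \<open>g - p\<close> for any \<open>p\<close> in the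
  multi-valued part.\<close>

lemma mv_boundedI:
  assumes lin: "mv_linear fock_scaleC G"
    and bound: "\<And>f g. (f, g) \<in> G \<Longrightarrow> \<exists>p. (0, p) \<in> G \<and> norm (g - p) \<le> C * norm f"
    and C: "C \<ge> 0"
  shows "mv_bounded G"
proof -
  have "mv_norm G \<le> ereal C"
    unfolding mv_norm_def
  proof (rule SUP_least)
    fix f assume "f \<in> {x \<in> Domain G. norm x \<le> 1}"
    then obtain g where g: "(f, g) \<in> G" and f: "norm f \<le> 1"
      by blast
    obtain p where p: "(0, p) \<in> G" "norm (g - p) \<le> C * norm f"
      using bound[OF g] by blast
    have "quot_norm (mv_single G f) = (INF e\<in>mv_E G. norm (g - e))"
      by (simp only: mv_single_eq[OF lin g] quot_norm_class)
    also have "\<dots> \<le> norm (g - p)"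
    proof (rule cINF_lower)
      show "bdd_below ((\<lambda>e. norm (g - e)) ` mv_E G)"
        by (rule bdd_belowI2[of _ 0]) simp
      show "p \<in> mv_E G"
        unfolding mv_E_def using p(1) closure_subset by blast
    qed
    also have "\<dots> \<le> C"
      using p(2) mult_left_mono[OF f C] by simp
    finally show "ereal (quot_norm (mv_single G f)) \<le> ereal C"
      by simp
  qed
  then show ?thesis
    unfolding mv_bounded_def using less_ereal.simps(4) le_less_trans by blast
qed

lemma psi_hat_eq_quotient:
  assumes "\<psi> holomorphic_on UNIV" "\<phi> holomorphic_on UNIV" "\<eta> holomorphic_on UNIV" "\<eta> z \<noteq> 0"
  shows "psi_hat m \<psi> \<phi> \<eta> z = \<psi> z * \<phi> z ^ m * inverse (\<eta> z)"
proof -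
  have "(\<lambda>z. \<psi> z * \<phi> z ^ m * inverse (\<eta> z)) analytic_on {z}"
    using assms by (intro analytic_intros) (auto simp: analytic_on_holomorphic)
  then show ?thesis
    unfolding psi_hat_def by (rule remove_sings_at_analytic)
qed

text \<open>Clearing the zeros of \<open>\<eta>\<close> from the defining equation: both sides are entire and agree where
  \<open>\<eta>\<close> is nonzero.\<close>

lemma S_max_psi_hat_identity:
  assumes hol: "\<psi> holomorphic_on UNIV" "\<phi> holomorphic_on UNIV" "\<eta> holomorphic_on UNIV"
    and \<eta>: "\<exists>z. \<eta> z \<noteq> 0" and h: "psi_hat m \<psi> \<phi> \<eta> holomorphic_on UNIV"
    and fg: "(f, g) \<in> S_max m \<psi> \<phi> \<eta>"
  shows "psi_hat m \<psi> \<phi> \<eta> z * fock_fun f (\<phi> z) = \<phi> z ^ m * (deriv ^^ m) (fock_fun g) z"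
proof (rule analytic_continuation_open[of "{z. \<eta> z \<noteq> 0}" UNIV
      "\<lambda>z. psi_hat m \<psi> \<phi> \<eta> z * fock_fun f (\<phi> z)" "\<lambda>z. \<phi> z ^ m * (deriv ^^ m) (fock_fun g) z"])
  show "open {z. \<eta> z \<noteq> 0}"
    by (intro open_Collect_neq holomorphic_on_imp_continuous_on hol continuous_on_const)
  show "{z. \<eta> z \<noteq> 0} \<noteq> {}"
    using \<eta> by blast
  have "(\<lambda>z. fock_fun f (\<phi> z)) holomorphic_on UNIV"
    using holomorphic_on_compose[OF hol(2) holomorphic_on_subset[OF fock_entire]] by (simp add: o_def)
  then show "(\<lambda>z. psi_hat m \<psi> \<phi> \<eta> z * fock_fun f (\<phi> z)) holomorphic_on UNIV"
    by (intro holomorphic_on_mult h)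
  show "(\<lambda>z. \<phi> z ^ m * (deriv ^^ m) (fock_fun g) z) holomorphic_on UNIV"
    by (intro holomorphic_on_mult holomorphic_on_power hol holomorphic_higher_deriv[OF fock_entire open_UNIV])
  fix w assume "w \<in> {z. \<eta> z \<noteq> 0}"
  then have w: "\<eta> w \<noteq> 0" by simp
  have "\<psi> w * fock_fun f (\<phi> w) = \<eta> w * (deriv ^^ m) (fock_fun g) w"
    using fg by (simp add: S_max_def)
  then have "inverse (\<eta> w) * (\<psi> w * fock_fun f (\<phi> w)) = (deriv ^^ m) (fock_fun g) w"
    using w by (simp add: field_simps)
  then have "\<phi> w ^ m * (deriv ^^ m) (fock_fun g) w = \<psi> w * \<phi> w ^ m * inverse (\<eta> w) * fock_fun f (\<phi> w)"
    by (metis mult.assoc mult.commute)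
  then show "psi_hat m \<psi> \<phi> \<eta> w * fock_fun f (\<phi> w) = \<phi> w ^ m * (deriv ^^ m) (fock_fun g) w"
    by (simp only: psi_hat_eq_quotient[OF hol w])
qed (simp_all add: connected_UNIV)

text \<open>The growth condition says that the weight \<open>\<bar>h z\<bar>\<^sup>2 * exp (- \<bar>z\<bar>\<^sup>2)\<close> is dominated by the Gaussian at
  \<open>A * z + B\<close>; the factor \<open>1 / \<bar>A\<bar>\<^sup>2\<close> is the Jacobian of the substitution.\<close>

lemma gauss_energy_weighted_composition_le:
  assumes F: "F holomorphic_on UNIV" and A: "A \<noteq> 0"
    and bound: "\<And>z. (cmod (h z))\<^sup>2 * exp ((cmod (A * z + B))\<^sup>2 - (cmod z)\<^sup>2) \<le> M"
  shows "gauss_energy (\<lambda>z. h z * F (A * z + B)) \<le> ennreal (M / (cmod A)\<^sup>2) * gauss_energy F"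
proof -
  note [measurable] = entire_borel_measurable[OF F]
  have M: "0 \<le> M"
    using order_trans[OF _ bound[of 0]] by simp
  let ?I = "\<integral>\<^sup>+z. ennreal ((cmod (F (A * z + B)))\<^sup>2 * fock_weight (A * z + B)) \<partial>lborel"
  have "gauss_energy (\<lambda>z. h z * F (A * z + B))
      \<le> (\<integral>\<^sup>+z. ennreal M * ennreal ((cmod (F (A * z + B)))\<^sup>2 * fock_weight (A * z + B)) \<partial>lborel)"
    unfolding gauss_energy_def
  proof (rule nn_integral_mono)
    fix z
    have "exp ((cmod (A * z + B))\<^sup>2 - (cmod z)\<^sup>2) * fock_weight (A * z + B) = fock_weight z"
      unfolding fock_weight_def by (simp add: exp_add[symmetric])
    then have "(cmod (h z * F (A * z + B)))\<^sup>2 * fock_weight z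
        = (cmod (h z))\<^sup>2 * exp ((cmod (A * z + B))\<^sup>2 - (cmod z)\<^sup>2)
          * ((cmod (F (A * z + B)))\<^sup>2 * fock_weight (A * z + B))"
      by (simp add: norm_mult power_mult_distrib mult_ac)
    also have "\<dots> \<le> M * ((cmod (F (A * z + B)))\<^sup>2 * fock_weight (A * z + B))"
      by (intro mult_right_mono bound mult_nonneg_nonneg less_imp_le[OF fock_weight_pos]) simp
    finally show "ennreal ((cmod (h z * F (A * z + B)))\<^sup>2 * fock_weight z)
        \<le> ennreal M * ennreal ((cmod (F (A * z + B)))\<^sup>2 * fock_weight (A * z + B))"
      by (subst ennreal_mult'[OF M, symmetric]) (rule ennreal_leI)
  qed
  also have "\<dots> = ennreal M * ?I"
    by (rule nn_integral_cmult) measurable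
  also have "ennreal M = ennreal (M / (cmod A)\<^sup>2) * ennreal ((cmod A)\<^sup>2)"
    using A M by (subst ennreal_mult'[symmetric]) simp_all
  also have "\<dots> * ?I = ennreal (M / (cmod A)\<^sup>2) * (ennreal ((cmod A)\<^sup>2) * ?I)"
    by (rule mult.assoc)
  also have "ennreal ((cmod A)\<^sup>2) * ?I = gauss_energy F"
    unfolding gauss_energy_def
    by (rule nn_integral_complex_affine[symmetric, OF _ A]) measurable
  finally show ?thesis .
qed

text \<open>The representative of \<open>g\<close> modulo polynomials is small in energy, and in particular it lies in the
  Fock space, so that its difference from \<open>g\<close> is an element of the multi-valued part.\<close>

lemma S_max_bounded_nonconstant:
  assumes hol: "\<psi> holomorphic_on UNIV" "\<phi> holomorphic_on UNIV" "\<eta> holomorphic_on UNIV"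
    and \<eta>: "\<exists>z. \<eta> z \<noteq> 0" and h: "psi_hat m \<psi> \<phi> \<eta> holomorphic_on UNIV"
    and bound: "\<And>z. (cmod (psi_hat m \<psi> \<phi> \<eta> z))\<^sup>2 * exp ((cmod (\<phi> z))\<^sup>2 - (cmod z)\<^sup>2) \<le> M"
    and \<phi>: "\<And>z. \<phi> z = A * z + B" and A: "A \<noteq> 0"
  shows "mv_bounded (S_max m \<psi> \<phi> \<eta>)"
proof -
  obtain C where C: "C \<ge> 0"
    "\<And>g. g holomorphic_on UNIV \<Longrightarrow> \<exists>G. G holomorphic_on UNIV \<and> (deriv ^^ m) G = (deriv ^^ m) g \<and>
      gauss_energy G \<le> ennreal C * gauss_energy (\<lambda>z. (z + B / A) ^ m * (deriv ^^ m) g z)"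
    using gauss_energy_reduce_mod_polynomials[of m "B / A"] by blast
  have M: "0 \<le> M"
    using order_trans[OF _ bound[of 0]] by simp
  define D where "D = C * ((cmod (inverse (A ^ m)))\<^sup>2 * (M / (cmod A)\<^sup>2))"
  have D: "0 \<le> D"
    using C(1) M by (simp add: D_def)
  show ?thesis
  proof (rule mv_boundedI[OF S_max_linear])
    show "0 \<le> sqrt D"
      using D by simp
    fix f g assume fg: "(f, g) \<in> S_max m \<psi> \<phi> \<eta>"
    let ?u = "(deriv ^^ m) (fock_fun g)"
    obtain G where G: "G holomorphic_on UNIV" "(deriv ^^ m) G = ?u"
      and G_le: "gauss_energy G \<le> ennreal C * gauss_energy (\<lambda>z. (z + B / A) ^ m * ?u z)"
      using C(2)[OF fock_entire] by blast
    have "(z + B / A) ^ m * ?u z = inverse (A ^ m) * (\<phi> z ^ m * ?u z)" for z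
    proof -
      have "\<phi> z = A * (z + B / A)"
        using A by (simp add: \<phi> distrib_left)
      then show ?thesis
        using A by (simp add: power_mult_distrib)
    qed
    then have "gauss_energy (\<lambda>z. (z + B / A) ^ m * ?u z)
        = ennreal ((cmod (inverse (A ^ m)))\<^sup>2) * gauss_energy (\<lambda>z. \<phi> z ^ m * ?u z)"
      by (simp only:) (intro gauss_energy_cmult holomorphic_on_mult holomorphic_on_power hol
          holomorphic_higher_deriv[OF fock_entire open_UNIV])
    also have "gauss_energy (\<lambda>z. \<phi> z ^ m * ?u z)
        = gauss_energy (\<lambda>z. psi_hat m \<psi> \<phi> \<eta> z * fock_fun f (A * z + B))"
      by (simp only: S_max_psi_hat_identity[OF hol \<eta> h fg, symmetric]) (simp only: \<phi>)
    also have "ennreal ((cmod (inverse (A ^ m)))\<^sup>2) * \<dots>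
        \<le> ennreal ((cmod (inverse (A ^ m)))\<^sup>2) * (ennreal (M / (cmod A)\<^sup>2) * gauss_energy (fock_fun f))"
      by (intro mult_left_mono gauss_energy_weighted_composition_le[OF fock_entire A])
         (use bound in \<open>simp_all add: \<phi>\<close>)
    finally have "ennreal C * gauss_energy (\<lambda>z. (z + B / A) ^ m * ?u z)
        \<le> ennreal C * (ennreal ((cmod (inverse (A ^ m)))\<^sup>2) * (ennreal (M / (cmod A)\<^sup>2) * gauss_energy (fock_fun f)))"
      by (rule mult_left_mono) simp
    also have "\<dots> = ennreal D * gauss_energy (fock_fun f)"
      by (simp only: D_def ennreal_mult'[OF C(1)] ennreal_mult'[OF zero_le_power2] mult.assoc)
    finally have G_le': "gauss_energy G \<le> ennreal D * gauss_energy (fock_fun f)"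
      using G_le by (rule order_trans[rotated])
    also have "\<dots> < \<infinity>"
      by (simp add: gauss_energy_fock_fun ennreal_mult_less_top)
    finally have "G \<in> fock_set"
      by (rule fock_set_if_gauss_energy_finite[OF G(1)])
    then obtain g' where g': "fock_fun g' = G"
      using Abs_fock_inverse by blast
    have "fock_fun (g - g') = (\<lambda>z. fock_fun g z - fock_fun g' z)"
      by (rule ext) simp
    then have "(deriv ^^ m) (fock_fun (g - g')) z = 0" for z
      using higher_deriv_diff[OF fock_entire[of g] fock_entire[of g'] open_UNIV UNIV_I, of m z] G(2) g'
      by simp
    then have "(0, g - g') \<in> S_max m \<psi> \<phi> \<eta>"
      by (simp add: S_max_def)
    moreover have "norm (g - (g - g')) \<le> sqrt D * norm f"
      using norm_fock_le_if_gauss_energy_le[of g' "sqrt D" f] G_le' D g' by simp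
    ultimately show "\<exists>p. (0, p) \<in> S_max m \<psi> \<phi> \<eta> \<and> norm (g - p) \<le> sqrt D * norm f"
      by blast
  qed
qed

lemma norm_fock_scaleC: "norm (fock_scaleC c f) = cmod c * norm f"
proof -
  have "fock_inner (fock_scaleC c f) (fock_scaleC c f) = c * cnj c * fock_inner f f"
    by (subst fock_inner_scaleC_left, subst fock_inner_cnj, subst fock_inner_scaleC_left)
       (simp add: fock_inner_self)
  also have "\<dots> = of_real ((cmod c)\<^sup>2) * fock_inner f f"
    by (simp only: complex_norm_square)
  finally have "fock_scaleC c f \<bullet> fock_scaleC c f = (cmod c)\<^sup>2 * (f \<bullet> f)"
    unfolding inner_fock_def by (simp del: of_real_power)
  then show ?thesis
    by (simp add: norm_eq_sqrt_inner real_sqrt_mult)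
qed

text \<open>Here \<open>(f, g)\<close> with \<open>f B = 0\<close> forces \<open>g\<close> into the multi-valued part. If \<open>f B\<close> is not zero on the whole domain,
  any one pair \<open>(f1, g1)\<close> with \<open>f1 B \<noteq> 0\<close> determines the operator up to that part: every \<open>g\<close> is
  congruent to \<open>(f B / f1 B) * g1\<close>.\<close>

lemma S_max_bounded_constant:
  assumes \<phi>: "\<And>z. \<phi> z = B"
  shows "mv_bounded (S_max m \<psi> \<phi> \<eta>)"
proof -
  obtain E where E: "E \<ge> 0" and ev: "\<And>F. F holomorphic_on UNIV \<Longrightarrow>
      ennreal ((cmod (F B))\<^sup>2) \<le> ennreal E * gauss_energy F"
    using gauss_energy_point_evaluation[of "cmod B"] by (metis order_refl)
  have eval: "cmod (fock_fun f B) \<le> sqrt (E * pi) * norm f" for f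
  proof -
    have "ennreal ((cmod (fock_fun f B))\<^sup>2) \<le> ennreal (E * (pi * (norm f)\<^sup>2))"
      using ev[OF fock_entire, of f] E by (simp only: gauss_energy_fock_fun ennreal_mult')
    then have "(cmod (fock_fun f B))\<^sup>2 \<le> E * (pi * (norm f)\<^sup>2)"
      using E by (subst (asm) ennreal_le_iff) auto
    also have "\<dots> = (sqrt (E * pi) * norm f)\<^sup>2"
      using E by (simp add: power_mult_distrib)
    finally show ?thesis
      by (rule power2_le_imp_le) (use E in simp)
  qed
  let ?G = "S_max m \<psi> \<phi> \<eta>"
  note sub = S_max_linear[of m \<psi> \<phi> \<eta>, unfolded mv_linear_def]
  have zero: "(0, g) \<in> ?G" if "(f, g) \<in> ?G" "fock_fun f B = 0" for f g
    using that by (simp add: S_max_def \<phi>)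
  show ?thesis
  proof (cases "\<exists>f g. (f, g) \<in> ?G \<and> fock_fun f B \<noteq> 0")
    case False
    then have "\<exists>p. (0, p) \<in> ?G \<and> norm (g - p) \<le> 0 * norm f" if "(f, g) \<in> ?G" for f g
      using zero[OF that] that by (intro exI[of _ g]) auto
    then show ?thesis
      by (rule mv_boundedI[OF S_max_linear]) simp_all
  next
    case True
    then obtain f1 g1 where fg1: "(f1, g1) \<in> ?G" and f1: "fock_fun f1 B \<noteq> 0"
      by blast
    show ?thesis
    proof (rule mv_boundedI[OF S_max_linear])
      show "0 \<le> sqrt (E * pi) / cmod (fock_fun f1 B) * norm g1"
        using E by simp
      fix f g assume fg: "(f, g) \<in> ?G"
      define c where "c = fock_fun f B / fock_fun f1 B"
      have "(fock_scaleC c f1, fock_scaleC c g1) \<in> ?G"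
        using module.subspace_scale[OF fock_prod_module sub fg1, of c] by simp
      from module.subspace_diff[OF fock_prod_module sub fg this]
      have "(f - fock_scaleC c f1, g - fock_scaleC c g1) \<in> ?G"
        by simp
      moreover have "fock_fun (f - fock_scaleC c f1) B = 0"
        using f1 by (simp add: c_def)
      ultimately have "(0, g - fock_scaleC c g1) \<in> ?G"
        by (rule zero)
      moreover have "norm (g - (g - fock_scaleC c g1))
          \<le> sqrt (E * pi) / cmod (fock_fun f1 B) * norm g1 * norm f"
      proof -
        have "norm (g - (g - fock_scaleC c g1)) = cmod (fock_fun f B) / cmod (fock_fun f1 B) * norm g1"
          by (simp add: norm_fock_scaleC c_def norm_divide)
        also have "\<dots> \<le> sqrt (E * pi) * norm f / cmod (fock_fun f1 B) * norm g1"
          by (intro mult_right_mono divide_right_mono eval) simp_all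
        finally show ?thesis
          by (simp add: mult_ac)
      qed
      ultimately show "\<exists>p. (0, p) \<in> ?G \<and>
          norm (g - p) \<le> sqrt (E * pi) / cmod (fock_fun f1 B) * norm g1 * norm f"
        by blast
    qed
  qed
qed

theorem theorem3p6:
  fixes m :: nat and \<psi> \<phi> \<eta> :: "complex \<Rightarrow> complex"
  assumes "\<psi> holomorphic_on UNIV" and "\<phi> holomorphic_on UNIV" and "\<eta> holomorphic_on UNIV"
    and "\<exists>z. \<psi> z \<noteq> 0" and "\<exists>z. \<eta> z \<noteq> 0"
    and "psi_hat m \<psi> \<phi> \<eta> holomorphic_on UNIV"
    and "bdd_above (range (\<lambda>z.
           (cmod (psi_hat m \<psi> \<phi> \<eta> z))\<^sup>2 * exp ((cmod (\<phi> z))\<^sup>2 - (cmod z)\<^sup>2)))"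
  shows "mv_bounded (S_max m \<psi> \<phi> \<eta>) \<and>
    (\<exists>A B. (\<forall>z. \<phi> z = A * z + B) \<and> cmod A \<le> 1)"
proof -
  note hol = assms(1-3)
  obtain M where M: "\<And>z. (cmod (psi_hat m \<psi> \<phi> \<eta> z))\<^sup>2 * exp ((cmod (\<phi> z))\<^sup>2 - (cmod z)\<^sup>2) \<le> M"
    using assms(7) by (auto simp: bdd_above_def)
  have affine: "\<exists>A B. (\<forall>z. \<phi> z = A * z + B) \<and> cmod A \<le> 1"
  proof (cases "\<exists>z. psi_hat m \<psi> \<phi> \<eta> z \<noteq> 0")
    case True
    show ?thesis
      by (rule gaussian_growth_imp_affine[OF assms(6) hol(2) M True])
  next
    case False
    have zero: "\<phi> z = 0" if "\<psi> z * \<eta> z \<noteq> 0" for z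
    proof -
      have "\<eta> z \<noteq> 0"
        using that by simp
      then have "\<psi> z * \<phi> z ^ m * inverse (\<eta> z) = 0"
        using False psi_hat_eq_quotient[OF hol, of z m] by simp
      then show ?thesis
        using that by simp
    qed
    \<comment> \<open>The ring of entire functions has no zero divisors.\<close>
    obtain w where w: "\<psi> w * \<eta> w \<noteq> 0"
    proof -
      obtain a where a: "\<psi> a \<noteq> 0"
        using assms(4) by blast
      have "\<exists>w\<in>{z. \<psi> z \<noteq> 0}. \<eta> w \<noteq> 0"
      proof (rule ccontr)
        assume "\<not> (\<exists>w\<in>{z. \<psi> z \<noteq> 0}. \<eta> w \<noteq> 0)"
        then have \<eta>_zero: "\<eta> z = 0" if "z \<in> {z. \<psi> z \<noteq> 0}" for z
          using that by blast
        have "open {z. \<psi> z \<noteq> 0}"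
          by (intro open_Collect_neq holomorphic_on_imp_continuous_on hol continuous_on_const)
        moreover have "{z. \<psi> z \<noteq> 0} \<noteq> {}"
          using a by blast
        ultimately have "\<eta> z = 0" for z
          by (rule analytic_continuation_open[OF _ open_UNIV _ connected_UNIV subset_UNIV hol(3)
                holomorphic_on_const \<eta>_zero UNIV_I])
        with assms(5) show False
          by simp
      qed
      then show ?thesis
        using that by auto
    qed
    have "\<phi> z = 0" for z
    proof (rule analytic_continuation_open[of "{z. \<psi> z * \<eta> z \<noteq> 0}" UNIV \<phi> "\<lambda>_. 0"])
      show "open {z. \<psi> z * \<eta> z \<noteq> 0}"
        by (intro open_Collect_neq holomorphic_on_imp_continuous_on holomorphic_on_mult hol continuous_on_const)
      show "{z. \<psi> z * \<eta> z \<noteq> 0} \<noteq> {}"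
        using w by blast
      show "\<phi> v = 0" if "v \<in> {z. \<psi> z * \<eta> z \<noteq> 0}" for v
        using that zero by blast
    qed (simp_all add: hol connected_UNIV)
    then have "\<forall>z. \<phi> z = 0 * z + 0"
      by simp
    then show ?thesis
      by (metis norm_zero zero_le_one)
  qed
  then obtain A B where AB: "\<And>z. \<phi> z = A * z + B"
    by blast
  have "mv_bounded (S_max m \<psi> \<phi> \<eta>)"
  proof (cases "A = 0")
    case True
    then show ?thesis
      using AB by (intro S_max_bounded_constant[of \<phi> B]) simp
  next
    case False
    show ?thesis
      by (rule S_max_bounded_nonconstant[OF hol assms(5,6) M AB False])
  qed
  with affine show ?thesis
    by blast
qed

end
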